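(* Let $f$ be a function with values in the natural numbers, $f:\{1,2,3,\ldots\}\to\mathbb{N}$. Then $f$ satisfies a linear recurrence relation over $\mathbb{Z}$ if and only if there exist two counting order invariant $\mathrm{MSOL}^1$-Specker functions $f_1,f_2$ such that $f(n)=f_1(n)-f_2(n)$ for all $n\ge 1$.
   Context: $\mathbb{N}=\{0,1,2,\ldots\}$ and $[n]=\{1,\ldots,n\}$. Structures have nonempty universes, so all counting functions are considered for arguments $n\ge 1$. A function $f:\{1,2,\ldots\}\to\mathbb{Z}$ satisfies a linear recurrence relation over $\mathbb{Z}$ if there are $d\ge 1$ and constants $a_1,\ldots,a_d\in\mathbb{Z}$ such that $f(n)=\sum_{j=1}^d a_j f(n-j)$ for all $n>d$. $\mathrm{MSOL}$ is Monadic Second Order Logic (first order logic with equality extended by quantification over subsets of the universe). Let $\bar R=(R_1,\ldots,R_s)$ be a finite tuple of relation symbols, $R_i$ of arity $\rho(i)$. A class $\mathcal{D}$ of ordered $\bar R$-structures is a class of finite $\bar R\cup\{<_1\}$-structures in which the binary symbol $<_1$ is always interpreted as a linear order of the universe. It is definable in $\mathrm{MSOL}$ if there is an $\mathrm{MSOL}$-sentence $\phi$ over the vocabulary $\bar R\cup\{<_1\}$ such that an ordered $\bar R$-structure is in $\mathcal{D}$ iff it satisfies $\phi$. For a linear order $<_1$ of $[n]$ let $$osp_{\mathcal{D}}(n,<_1)=\big|\{(R_1,\ldots,R_s): R_i\subseteq[n]^{\rho(i)},\ \langle[n],<_1,R_1,\ldots,R_s\rangle\in\mathcal{D}\}\big|.$$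 A function $f:\{1,2,\ldots\}\to\mathbb{N}$ is a counting order invariant $\mathrm{MSOL}^k$-Specker function if there are a finite set of relation symbols $\bar R$ of arity at most $k$ (the order symbol is not counted here) and a class $\mathcal{D}$ of ordered $\bar R$-structures definable in $\mathrm{MSOL}$ such that for all $n\ge 1$ and all linear orders $<_1,<_2$ of $[n]$ we have $f(n)=osp_{\mathcal{D}}(n,<_1)=osp_{\mathcal{D}}(n,<_2)$. Here $k=1$, so all symbols in $\bar R$ are unary. *)

theory Defs
  imports Main
begin

text \<open>
  A vocabulary is a list of arities \<open>\<rho>\<close>: the relation symbol \<open>R\<^sub>i\<close> (\<open>i < length \<rho>\<close>) has arity \<open>\<rho> ! i\<close>.
  The symbol for the linear order is always present in addition and is not listed in \<open>\<rho>\<close>.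
  A tuple is a list over the universe.
\<close>

record 'a ostruct =
  univ :: "'a set"
  ord_rel :: "'a rel"
  rels :: "'a list set list"

definition rel_interp :: "nat list \<Rightarrow> 'a set \<Rightarrow> 'a list set list \<Rightarrow> bool" where
  "rel_interp \<rho> A Rs \<longleftrightarrow> list_all2 (\<lambda>r R. R \<subseteq> {xs. set xs \<subseteq> A \<and> length xs = r}) \<rho> Rs"

text \<open>
  The order symbol \<open><\<close> is read as a strict order; \<open>strict_linear_order_on\<close> by itself does not
  confine the relation to \<open>A\<close>.
\<close>

definition lin_order_of :: "'a set \<Rightarrow> 'a rel \<Rightarrow> bool" where
  "lin_order_of A l \<longleftrightarrow> l \<subseteq> A \<times> A \<and> strict_linear_order_on A l"

definition ordered_structure :: "nat list \<Rightarrow> 'a ostruct \<Rightarrow> bool" where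
  "ordered_structure \<rho> S \<longleftrightarrow>
     finite (univ S) \<and> univ S \<noteq> {} \<and> lin_order_of (univ S) (ord_rel S) \<and>
     rel_interp \<rho> (univ S) (rels S)"

text \<open>
  First-order and set variables are two separate families, both named by natural numbers:
  \<open>Ex1 x\<close> binds the element variable \<open>x\<close>, \<open>Ex2 X\<close> binds the set variable \<open>X\<close>, and
  \<open>Mem x X\<close> says that element \<open>x\<close> lies in set \<open>X\<close>. The other connectives and the universal
  quantifiers are definable as usual.
\<close>

datatype msol =
    Eq nat nat
  | Less nat nat
  | Rel nat "nat list"
  | Mem nat nat
  | Neg msol
  | Conj msol msol
  | Ex1 nat msol
  | Ex2 nat msol

primrec wf_msol :: "nat list \<Rightarrow> msol \<Rightarrow> bool" where
  "wf_msol \<rho> (Eq x y) \<longleftrightarrow> True"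
| "wf_msol \<rho> (Less x y) \<longleftrightarrow> True"
| "wf_msol \<rho> (Rel i xs) \<longleftrightarrow> i < length \<rho> \<and> length xs = \<rho> ! i"
| "wf_msol \<rho> (Mem x X) \<longleftrightarrow> True"
| "wf_msol \<rho> (Neg \<phi>) \<longleftrightarrow> wf_msol \<rho> \<phi>"
| "wf_msol \<rho> (Conj \<phi> \<psi>) \<longleftrightarrow> wf_msol \<rho> \<phi> \<and> wf_msol \<rho> \<psi>"
| "wf_msol \<rho> (Ex1 x \<phi>) \<longleftrightarrow> wf_msol \<rho> \<phi>"
| "wf_msol \<rho> (Ex2 X \<phi>) \<longleftrightarrow> wf_msol \<rho> \<phi>"

primrec fv1 :: "msol \<Rightarrow> nat set" where
  "fv1 (Eq x y) = {x, y}"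
| "fv1 (Less x y) = {x, y}"
| "fv1 (Rel i xs) = set xs"
| "fv1 (Mem x X) = {x}"
| "fv1 (Neg \<phi>) = fv1 \<phi>"
| "fv1 (Conj \<phi> \<psi>) = fv1 \<phi> \<union> fv1 \<psi>"
| "fv1 (Ex1 x \<phi>) = fv1 \<phi> - {x}"
| "fv1 (Ex2 X \<phi>) = fv1 \<phi>"

primrec fv2 :: "msol \<Rightarrow> nat set" where
  "fv2 (Eq x y) = {}"
| "fv2 (Less x y) = {}"
| "fv2 (Rel i xs) = {}"
| "fv2 (Mem x X) = {X}"
| "fv2 (Neg \<phi>) = fv2 \<phi>"
| "fv2 (Conj \<phi> \<psi>) = fv2 \<phi> \<union> fv2 \<psi>"
| "fv2 (Ex1 x \<phi>) = fv2 \<phi>"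
| "fv2 (Ex2 X \<phi>) = fv2 \<phi> - {X}"

definition msol_sentence :: "nat list \<Rightarrow> msol \<Rightarrow> bool" where
  "msol_sentence \<rho> \<phi> \<longleftrightarrow> wf_msol \<rho> \<phi> \<and> fv1 \<phi> = {} \<and> fv2 \<phi> = {}"

primrec sat :: "'a ostruct \<Rightarrow> (nat \<Rightarrow> 'a) \<Rightarrow> (nat \<Rightarrow> 'a set) \<Rightarrow> msol \<Rightarrow> bool" where
  "sat S v V (Eq x y) \<longleftrightarrow> v x = v y"
| "sat S v V (Less x y) \<longleftrightarrow> (v x, v y) \<in> ord_rel S"
| "sat S v V (Rel i xs) \<longleftrightarrow> map v xs \<in> rels S ! i"
| "sat S v V (Mem x X) \<longleftrightarrow> v x \<in> V X"
| "sat S v V (Neg \<phi>) \<longleftrightarrow> \<not> sat S v V \<phi>"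
| "sat S v V (Conj \<phi> \<psi>) \<longleftrightarrow> sat S v V \<phi> \<and> sat S v V \<psi>"
| "sat S v V (Ex1 x \<phi>) \<longleftrightarrow> (\<exists>a\<in>univ S. sat S (v(x := a)) V \<phi>)"
| "sat S v V (Ex2 X \<phi>) \<longleftrightarrow> (\<exists>A. A \<subseteq> univ S \<and> sat S v (V(X := A)) \<phi>)"

definition models :: "'a ostruct \<Rightarrow> msol \<Rightarrow> bool" where
  "models S \<phi> \<longleftrightarrow>
     (\<forall>v V. (\<forall>x. v x \<in> univ S) \<longrightarrow> (\<forall>X. V X \<subseteq> univ S) \<longrightarrow> sat S v V \<phi>)"

text \<open>
  Classes of structures are sets of structures over one type of elements. The counting
  functions use the type \<open>nat\<close>, which contains every set \<open>{1..n}\<close> and an isomorphic copy of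
  every finite structure.
\<close>

definition ordered_class :: "nat list \<Rightarrow> 'a ostruct set \<Rightarrow> bool" where
  "ordered_class \<rho> D \<longleftrightarrow> (\<forall>S\<in>D. ordered_structure \<rho> S)"

definition msol_definable :: "nat list \<Rightarrow> 'a ostruct set \<Rightarrow> bool" where
  "msol_definable \<rho> D \<longleftrightarrow>
     (\<exists>\<phi>. msol_sentence \<rho> \<phi> \<and> (\<forall>S. ordered_structure \<rho> S \<longrightarrow> (S \<in> D \<longleftrightarrow> models S \<phi>)))"

definition osp :: "nat list \<Rightarrow> nat ostruct set \<Rightarrow> nat \<Rightarrow> nat rel \<Rightarrow> nat" where
  "osp \<rho> D n l =
     card {Rs. rel_interp \<rho> {1..n} Rs \<and> \<lparr>univ = {1..n}, ord_rel = l, rels = Rs\<rparr> \<in> D}"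

text \<open>
  Functions on the positive integers are total functions on \<open>nat\<close> whose value at \<open>0\<close> is
  never inspected. Relation symbols have positive arity, so for \<open>k = 1\<close> they are all unary.
\<close>

definition counting_order_invariant_msol_specker :: "nat \<Rightarrow> (nat \<Rightarrow> nat) \<Rightarrow> bool" where
  "counting_order_invariant_msol_specker k f \<longleftrightarrow>
     (\<exists>\<rho> D. (\<forall>r\<in>set \<rho>. 1 \<le> r \<and> r \<le> k) \<and> ordered_class \<rho> D \<and> msol_definable \<rho> D \<and>
        (\<forall>n\<ge>1. \<forall>l1 l2. lin_order_of {1..n} l1 \<longrightarrow> lin_order_of {1..n} l2 \<longrightarrow>
           f n = osp \<rho> D n l1 \<and> osp \<rho> D n l1 = osp \<rho> D n l2))"

definition satisfies_linear_recurrence :: "(nat \<Rightarrow> int) \<Rightarrow> bool" where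
  "satisfies_linear_recurrence f \<longleftrightarrow>
     (\<exists>d\<ge>1. \<exists>a :: nat \<Rightarrow> int. \<forall>n>d. f n = (\<Sum>j=1..d. a j * f (n - j)))"

end

theory Submission
  imports Defs "Jordan_Normal_Form.Char_Poly"
begin

text \<open>
  Listing the universe in increasing order turns an ordered structure with unary relations into a
  word. By Buechi's argument the words of the models of a sentence form a regular language, that
  is, one with finitely many left quotients. The numbers of words of length \<open>n\<close> in these
  quotients satisfy a linear system \<open>G (n + 1) = A (G n)\<close>, so the characteristic polynomial of
  \<open>A\<close> annihilates each of them, and a product of two monic annihilators annihilates a difference.

  Conversely, the companion matrix of a recurrence expresses \<open>f n\<close> as a signed count of walks of
  length \<open>n\<close> in a finite digraph. The walks of either sign are the models of a first-order
  sentence with one unary symbol for each state.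
\<close>

section \<open>Sequences annihilated by a monic polynomial in the shift\<close>

text \<open>No division ever occurs: the characteristic polynomial of an integer matrix is monic, so
  the recurrences obtained have integer coefficients. Order invariance comes for free, since all
  linear orders of n elements are isomorphic and the word of a structure keeps the order only as the
  order of its positions. A count is nonnegative, whereas a recurrence may have negative
  coefficients; this is why two functions are needed. The sign of a walk is made part of its states,
  and the walks ending with either sign are counted separately. Working with quotients instead of
  automata turns the powerset construction into a remark on sets of languages. It also permits
  letters that record infinitely many variables, so that the free variables of a formula need no
  bookkeeping. The argument 0 shapes several statements: universes are nonempty and the values at 0
  are arbitrary, so functions are compared from 1 on, and walks start from the values at 1.\<close>

definition shift_act :: "int poly \<Rightarrow> (nat \<Rightarrow> int) \<Rightarrow> nat \<Rightarrow> int" where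
  "shift_act p g n = (\<Sum>i\<le>degree p. coeff p i * g (n + i))"

lemma shift_act_bound:
  assumes "degree p \<le> N"
  shows "shift_act p g n = (\<Sum>i\<le>N. coeff p i * g (n + i))"
  unfolding shift_act_def
  by (rule sum.mono_neutral_left) (use assms in \<open>auto simp: coeff_eq_0\<close>)

lemma shift_act_0 [simp]: "shift_act 0 g n = 0"
  by (simp add: shift_act_def)

text \<open>The degree does not go up when \<open>p = 0\<close>, so the sum is padded with a zero
  coefficient by \<open>shift_act_bound\<close>. This is the recursion behind all later inductions
  on polynomials.\<close>

lemma shift_act_pCons: "shift_act (pCons a p) g n = a * g n + shift_act p g (Suc n)"
proof -
  have "shift_act (pCons a p) g n = (\<Sum>i\<le>Suc (degree p). coeff (pCons a p) i * g (n + i))"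
    by (rule shift_act_bound) (simp add: degree_pCons_le)
  also have "\<dots> = a * g n + (\<Sum>i\<le>degree p. coeff p i * g (n + Suc i))"
    by (subst sum.atMost_Suc_shift) simp
  finally show ?thesis by (simp add: shift_act_def)
qed

lemma shift_act_1 [simp]: "shift_act 1 g n = g n"
  by (simp add: shift_act_def)

lemma shift_act_add: "shift_act (p + q) g n = shift_act p g n + shift_act q g n"
  by (induction p q arbitrary: n rule: poly_induct2) (simp_all add: shift_act_pCons algebra_simps)

lemma shift_act_smult: "shift_act (Polynomial.smult c p) g n = c * shift_act p g n"
  by (induction p arbitrary: n) (simp_all add: shift_act_pCons algebra_simps)

text \<open>Sequences thus form a module over the integer polynomials, with x acting as the shift,
  and commutativity of the polynomial ring makes any two such operators commute.\<close>

lemma shift_act_mult: "shift_act (p * q) g n = shift_act p (shift_act q g) n"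
  by (induction p arbitrary: n)
    (simp_all add: shift_act_pCons shift_act_add shift_act_smult algebra_simps)

lemma shift_act_sum: "shift_act (\<Sum>i\<in>I. p i) g n = (\<Sum>i\<in>I. shift_act (p i) g n)"
  by (induction I rule: infinite_finite_induct) (simp_all add: shift_act_add)

lemma shift_act_fun_sum:
  "shift_act p (\<lambda>m. \<Sum>i\<in>I. g i m) n = (\<Sum>i\<in>I. shift_act p (g i) n)"
  by (simp add: shift_act_def sum_distrib_left sum.swap[of _ I])

lemma shift_act_fun_diff:
  "shift_act p (\<lambda>m. g m - h m) n = shift_act p g n - shift_act p h n"
  by (simp add: shift_act_def sum_subtractf algebra_simps)

lemma shift_act_fun_0 [simp]: "shift_act p (\<lambda>m. 0) n = 0"
  by (simp add: shift_act_def)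

text \<open>Unlike the recurrence of the theorem, the relation holds from index 0 on, and degree 0
  is allowed.\<close>

definition C_recursive :: "(nat \<Rightarrow> int) \<Rightarrow> bool" where
  "C_recursive g \<longleftrightarrow> (\<exists>p. lead_coeff p = 1 \<and> (\<forall>n. shift_act p g n = 0))"

lemma C_recursive_diff:
  assumes "C_recursive g" "C_recursive h"
  shows "C_recursive (\<lambda>n. g n - h n)"
proof -
  obtain p q where p: "lead_coeff p = 1" "\<And>n. shift_act p g n = 0"
    and q: "lead_coeff q = 1" "\<And>n. shift_act q h n = 0"
    using assms unfolding C_recursive_def by blast
  have "shift_act (p * q) (\<lambda>n. g n - h n) n = 0" for n
  proof -
    have "shift_act p g = (\<lambda>_. 0)" "shift_act q h = (\<lambda>_. 0)" using p(2) q(2) by auto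
    then have "shift_act (p * q) h n = 0" "shift_act (q * p) g n = 0"
      unfolding shift_act_mult by simp_all
    then show ?thesis by (simp add: shift_act_fun_diff mult.commute)
  qed
  then show ?thesis
    unfolding C_recursive_def using p(1) q(1) by (intro exI[of _ "p * q"]) (simp add: lead_coeff_mult)
qed

text \<open>Multiply \<open>(E - A) g = 0\<close>, where \<open>E\<close> is the shift, by the adjugate of \<open>E - A\<close>.\<close>

lemma C_recursive_system_nat:
  fixes a :: "nat \<Rightarrow> nat \<Rightarrow> int"
  assumes rec: "\<And>i n. i < m \<Longrightarrow> g i (Suc n) = (\<Sum>j<m. a i j * g j n)" and "l < m"
  shows "C_recursive (g l)"
proof -
  define A where "A = mat m m (\<lambda>(i, j). a i j)"
  have A: "A \<in> carrier_mat m m" by (simp add: A_def)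
  define Q where "Q = char_poly_matrix A"
  have Q: "Q \<in> carrier_mat m m" using A by (simp add: Q_def)
  note adj = adj_mat[OF Q]
  \<comment> \<open>\<open>Q\<close> is x times the identity minus \<open>A\<close>; with x acting
    as the shift, its row \<open>i\<close> applied to the vector \<open>g\<close> is the given
    recurrence for \<open>g i\<close>.\<close>
  have Qg: "(\<Sum>j<m. shift_act (Q $$ (i, j)) (g j) n) = 0" if "i < m" for i n
  proof -
    have "shift_act (Q $$ (i, j)) (g j) n = (if j = i then g i (Suc n) else 0) - a i j * g j n"
      if "j < m" for j
      using that \<open>i < m\<close> by (simp add: Q_def char_poly_matrix_def A_def shift_act_pCons)
    then have "(\<Sum>j<m. shift_act (Q $$ (i, j)) (g j) n)
        = (\<Sum>j<m. (if j = i then g i (Suc n) else 0) - a i j * g j n)"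
      by simp
    also have "\<dots> = 0" using that by (simp add: sum_subtractf rec)
    finally show ?thesis .
  qed
  have "shift_act (char_poly A) (g l) n = 0" for n
  proof -
    \<comment> \<open>Row \<open>l\<close> of the identity between the adjugate times
      \<open>Q\<close> and \<open>det Q\<close> times the unit matrix. It isolates the single
      sequence \<open>g l\<close>.\<close>
    have entry: "(\<Sum>i<m. adj_mat Q $$ (l, i) * Q $$ (i, j)) = (if j = l then det Q else 0)"
      if "j < m" for j
    proof -
      have "(adj_mat Q * Q) $$ (l, j) = (\<Sum>i<m. adj_mat Q $$ (l, i) * Q $$ (i, j))"
        using that \<open>l < m\<close> adj(1) Q
        by (simp add: scalar_prod_def atLeast0LessThan)
      moreover have "(adj_mat Q * Q) $$ (l, j) = (if j = l then det Q else 0)"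
        unfolding adj(3) using that \<open>l < m\<close> by simp
      ultimately show ?thesis by simp
    qed
    have "0 = (\<Sum>i<m. shift_act (adj_mat Q $$ (l, i)) (\<lambda>n. \<Sum>j<m. shift_act (Q $$ (i, j)) (g j) n) n)"
      using Qg by simp
    also have "\<dots> = (\<Sum>j<m. shift_act (\<Sum>i<m. adj_mat Q $$ (l, i) * Q $$ (i, j)) (g j) n)"
      unfolding shift_act_fun_sum shift_act_sum by (subst sum.swap) (simp add: shift_act_mult)
    also have "\<dots> = (\<Sum>j<m. if j = l then shift_act (det Q) (g l) n else 0)"
      by (rule sum.cong) (auto simp: entry)
    also have "\<dots> = shift_act (det Q) (g l) n"
      using \<open>l < m\<close> by simp
    finally show ?thesis by (simp add: Q_def char_poly_def)
  qed
  moreover have "lead_coeff (char_poly A) = 1"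
    using degree_monic_char_poly[OF A] by simp
  ultimately show ?thesis unfolding C_recursive_def by blast
qed

text \<open>Transport along a bijection from matrix indices to \<open>I\<close>; later
  \<open>I\<close> is a set of languages.\<close>

lemma C_recursive_system:
  assumes "finite I" and "k \<in> I"
    and rec: "\<And>i n. i \<in> I \<Longrightarrow> g i (Suc n) = (\<Sum>j\<in>I. a i j * g j n)"
  shows "C_recursive (g k)"
proof -
  obtain h where h: "bij_betw h {..<card I} I"
    using ex_bij_betw_nat_finite[OF \<open>finite I\<close>] by (auto simp: atLeast0LessThan)
  obtain l where l: "l < card I" "h l = k"
    using bij_betw_imp_surj_on[OF h] \<open>k \<in> I\<close> by (metis imageE lessThan_iff)
  have "C_recursive (g (h l))"
  proof (rule C_recursive_system_nat[where g = "\<lambda>i. g (h i)" and a = "\<lambda>i j. a (h i) (h j)" and m = "card I"])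
    fix i n assume "i < card I"
    then have "h i \<in> I" using bij_betwE[OF h] by simp
    then show "g (h i) (Suc n) = (\<Sum>j<card I. a (h i) (h j) * g (h j) n)"
      by (simp add: rec sum.reindex_bij_betw[OF h, of "\<lambda>j. a (h i) j * g j n"])
  qed (rule l(1))
  then show ?thesis by (simp add: l)
qed

lemma satisfies_linear_recurrenceI:
  assumes "C_recursive g" and fg: "\<And>n. n \<ge> 1 \<Longrightarrow> f n = g n"
  shows "satisfies_linear_recurrence f"
proof -
  obtain q where q: "lead_coeff q = 1" "\<And>n. shift_act q g n = 0"
    using assms(1) unfolding C_recursive_def by blast
  \<comment> \<open>The factor x secures a positive order, because \<open>q\<close> may have degree
    0.\<close>
  define p where "p = pCons 0 q"
  have "q \<noteq> 0" using q(1) by auto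
  then have lead: "lead_coeff p = 1" and deg: "degree p \<ge> 1"
    using q(1) by (simp_all add: p_def)
  have act: "shift_act p g n = 0" for n
    by (simp add: p_def shift_act_pCons q(2))
  define d where "d = degree p"
  have "f n = (\<Sum>j=1..d. - coeff p (d - j) * f (n - j))" if "n > d" for n
  proof -
    have "0 = (\<Sum>i\<le>d. coeff p i * g (n - d + i))"
      using act[of "n - d"] by (simp add: shift_act_def d_def)
    \<comment> \<open>The smallest index is \<open>n - d\<close>, which is at least 1, so
      \<open>g\<close> and \<open>f\<close> agree on all indices that occur.\<close>
    also have "\<dots> = (\<Sum>i\<le>d. coeff p i * f (n - d + i))"
      using that by (intro sum.cong) (auto simp: fg)
    also have "\<dots> = f n + (\<Sum>i<d. coeff p i * f (n - d + i))"
      using lead that by (simp add: lessThan_Suc_atMost[symmetric] d_def)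
    also have "(\<Sum>i<d. coeff p i * f (n - d + i)) = (\<Sum>j=1..d. coeff p (d - j) * f (n - j))"
      by (rule sum.reindex_bij_witness[of _ "\<lambda>j. d - j" "\<lambda>i. d - i"]) (use that in auto)
    finally show ?thesis by (simp add: sum_negf)
  qed
  then show ?thesis
    unfolding satisfies_linear_recurrence_def using deg
    by (intro exI[of _ d] conjI exI[of _ "\<lambda>j. - coeff p (d - j)"]) (auto simp: d_def)
qed

section \<open>Regular languages\<close>

text \<open>The quotient by \<open>u\<close> plays the role of the state that a deterministic
  automaton reaches after reading \<open>u\<close>.\<close>

definition lquot :: "'a list \<Rightarrow> 'a list set \<Rightarrow> 'a list set" where
  "lquot u L = {v. u @ v \<in> L}"

lemma in_lquot_iff [simp]: "v \<in> lquot u L \<longleftrightarrow> u @ v \<in> L"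
  by (simp add: lquot_def)

lemma lquot_Nil [simp]: "lquot [] L = L"
  by (simp add: lquot_def)

lemma lquot_lquot: "lquot u' (lquot u L) = lquot (u @ u') L"
  by (simp add: lquot_def)

text \<open>Regularity in the sense of Myhill and Nerode; the alphabet may be infinite.\<close>

definition regular :: "'a list set \<Rightarrow> bool" where
  "regular L \<longleftrightarrow> finite (range (\<lambda>u. lquot u L))"

lemma regularI:
  assumes "finite F" "\<And>u. lquot u L \<in> F"
  shows "regular L"
  unfolding regular_def by (rule finite_subset[OF _ assms(1)]) (use assms(2) in auto)

lemma regular_Compl:
  assumes "regular L"
  shows "regular (- L)"
proof (rule regularI)
  show "finite (uminus ` range (\<lambda>u. lquot u L))"
    using assms by (simp add: regular_def)
  show "lquot u (- L) \<in> uminus ` range (\<lambda>u. lquot u L)" for u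
  proof -
    have "lquot u (- L) = - lquot u L" by auto
    then show ?thesis by blast
  qed
qed

lemma regular_Int:
  assumes "regular L" "regular K"
  shows "regular (L \<inter> K)"
proof (rule regularI)
  show "finite ((\<lambda>(A, B). A \<inter> B) ` (range (\<lambda>u. lquot u L) \<times> range (\<lambda>u. lquot u K)))"
    using assms by (simp add: regular_def)
  show "lquot u (L \<inter> K) \<in> (\<lambda>(A, B). A \<inter> B) ` (range (\<lambda>u. lquot u L) \<times> range (\<lambda>u. lquot u K))" for u
  proof (rule image_eqI)
    show "lquot u (L \<inter> K) = (\<lambda>(A, B). A \<inter> B) (lquot u L, lquot u K)" by auto
  qed auto
qed

text \<open>Projection of words: every letter may be guessed anew within \<open>R\<close>. This is
  the counterpart of existential quantification.\<close>

definition relabel :: "('a \<Rightarrow> 'b \<Rightarrow> bool) \<Rightarrow> 'b list set \<Rightarrow> 'a list set" where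
  "relabel R L = {w. \<exists>w'\<in>L. list_all2 R w w'}"

text \<open>The subset construction: the quotient of the relabelled language by \<open>u\<close> is
  the union of the relabelled quotients of \<open>L\<close> over all guesses \<open>u'\<close> for
  \<open>u\<close>, hence determined by a subset of the finitely many quotients of
  \<open>L\<close>.\<close>

lemma regular_relabel:
  assumes "regular L"
  shows "regular (relabel R L)"
proof (rule regularI)
  let ?Q = "range (\<lambda>u. lquot u L)"
  show "finite ((\<lambda>F. \<Union> (relabel R ` F)) ` Pow ?Q)"
    using assms by (simp add: regular_def)
  show "lquot u (relabel R L) \<in> (\<lambda>F. \<Union> (relabel R ` F)) ` Pow ?Q" for u
  proof (rule image_eqI)
    let ?F = "(\<lambda>u'. lquot u' L) ` {u'. list_all2 R u u'}"
    show "lquot u (relabel R L) = \<Union> (relabel R ` ?F)"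
    proof (intro equalityI subsetI)
      fix v assume "v \<in> lquot u (relabel R L)"
      then obtain u' v' where "u' @ v' \<in> L" "list_all2 R u u'" "list_all2 R v v'"
        by (auto simp: relabel_def list_all2_append1)
      then show "v \<in> \<Union> (relabel R ` ?F)"
        by (auto simp: relabel_def intro!: exI[of _ u'] bexI[of _ v'])
    qed (auto simp: relabel_def intro: list_all2_appendI)
    show "?F \<in> Pow ?Q" by auto
  qed
qed

definition occurs :: "('a \<Rightarrow> bool) \<Rightarrow> 'a list set" where
  "occurs P = {w. \<exists>i<length w. P (w ! i)}"

text \<open>Serves the order atoms. With \<open>P\<close> equal to \<open>Q\<close> it says that
  \<open>P\<close> holds at two different positions, so its complement expresses uniqueness.\<close>

definition occurs_before :: "('a \<Rightarrow> bool) \<Rightarrow> ('a \<Rightarrow> bool) \<Rightarrow> 'a list set" where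
  "occurs_before P Q = {w. \<exists>i j. i < j \<and> j < length w \<and> P (w ! i) \<and> Q (w ! j)}"

lemma occurs_iff: "w \<in> occurs P \<longleftrightarrow> (\<exists>a\<in>set w. P a)"
  unfolding occurs_def by (simp add: Bex_def) (metis in_set_conv_nth)

lemma occurs_beforeI:
  "i < j \<Longrightarrow> j < length w \<Longrightarrow> P (w ! i) \<Longrightarrow> Q (w ! j) \<Longrightarrow> w \<in> occurs_before P Q"
  by (auto simp: occurs_before_def)

lemma Nil_notin_occurs_before [simp]: "[] \<notin> occurs_before P Q"
  by (simp add: occurs_before_def)

lemma Cons_in_occurs_before:
  "a # w \<in> occurs_before P Q \<longleftrightarrow> P a \<and> w \<in> occurs Q \<or> w \<in> occurs_before P Q"
proof
  assume "a # w \<in> occurs_before P Q"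
  then obtain i j where ij: "i < j" "j < Suc (length w)" "P ((a # w) ! i)" "Q ((a # w) ! j)"
    by (auto simp: occurs_before_def)
  then obtain j' where j': "j = Suc j'" by (cases j) auto
  show "P a \<and> w \<in> occurs Q \<or> w \<in> occurs_before P Q"
  proof (cases i)
    case 0
    then show ?thesis using ij j' by (auto simp: occurs_def)
  next
    case (Suc i')
    then show ?thesis using ij j' by (auto simp: occurs_before_def)
  qed
next
  assume "P a \<and> w \<in> occurs Q \<or> w \<in> occurs_before P Q"
  then show "a # w \<in> occurs_before P Q"
  proof (elim disjE conjE)
    assume "P a" "w \<in> occurs Q"
    then obtain j where "j < length w" "Q (w ! j)" by (auto simp: occurs_def)
    then show ?thesis using \<open>P a\<close>
      unfolding occurs_before_def by (intro CollectI exI[of _ 0] exI[of _ "Suc j"]) simp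
  next
    assume "w \<in> occurs_before P Q"
    then obtain i j where "i < j" "j < length w" "P (w ! i)" "Q (w ! j)"
      by (auto simp: occurs_before_def)
    then show ?thesis
      unfolding occurs_before_def by (intro CollectI exI[of _ "Suc i"] exI[of _ "Suc j"]) simp
  qed
qed

lemma append_in_occurs_before:
  "u @ v \<in> occurs_before P Q \<longleftrightarrow>
     u \<in> occurs_before P Q \<or> u \<in> occurs P \<and> v \<in> occurs Q \<or> v \<in> occurs_before P Q"
  by (induction u) (auto simp: Cons_in_occurs_before occurs_iff)

lemma occurs_before_imp_occurs: "w \<in> occurs_before P Q \<Longrightarrow> w \<in> occurs Q"
  by (auto simp: occurs_before_def occurs_def)

lemma regular_occurs: "regular (occurs P)"
proof (rule regularI)
  show "finite {UNIV, occurs P}" by simp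
  show "lquot u (occurs P) \<in> {UNIV, occurs P}" for u
    by (cases "u \<in> occurs P") (auto simp: occurs_iff)
qed

text \<open>Of a prefix only one of three things has to be remembered: a pair has been completed,
  \<open>P\<close> has been seen, or neither. Once \<open>P\<close> has been seen, a later pair also
  contains an occurrence of \<open>Q\<close>, so \<open>occurs Q\<close> alone describes the good
  continuations.\<close>

lemma regular_occurs_before: "regular (occurs_before P Q)"
proof (rule regularI)
  show "finite {UNIV, occurs Q, occurs_before P Q}" by simp
  show "lquot u (occurs_before P Q) \<in> {UNIV, occurs Q, occurs_before P Q}" for u
  proof (cases "u \<in> occurs_before P Q")
    case True
    then have "lquot u (occurs_before P Q) = UNIV" by (auto simp: append_in_occurs_before)
    then show ?thesis by simp
  next
    case False
    then have "lquot u (occurs_before P Q) = (if u \<in> occurs P then occurs Q else occurs_before P Q)"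
      by (auto simp: append_in_occurs_before dest: occurs_before_imp_occurs)
    then show ?thesis by simp
  qed
qed

section \<open>Counting the words of a regular language over a finite alphabet\<close>

definition words_in :: "'a set \<Rightarrow> 'a list set \<Rightarrow> nat \<Rightarrow> 'a list set" where
  "words_in \<Sigma> L n = {w. length w = n \<and> set w \<subseteq> \<Sigma> \<and> w \<in> L}"

lemma finite_words_in: "finite \<Sigma> \<Longrightarrow> finite (words_in \<Sigma> L n)"
  unfolding words_in_def by (rule finite_subset[OF _ finite_lists_length_eq[of \<Sigma> n]]) auto

lemma card_words_in_Suc:
  assumes "finite \<Sigma>"
  shows "card (words_in \<Sigma> L (Suc n)) = (\<Sum>a\<in>\<Sigma>. card (words_in \<Sigma> (lquot [a] L) n))"
proof -
  have "words_in \<Sigma> L (Suc n) = (\<Union>a\<in>\<Sigma>. (#) a ` words_in \<Sigma> (lquot [a] L) n)"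
    by (auto simp: words_in_def length_Suc_conv image_iff)
  then have "card (words_in \<Sigma> L (Suc n)) = (\<Sum>a\<in>\<Sigma>. card ((#) a ` words_in \<Sigma> (lquot [a] L) n))"
    using assms by (simp only:) (intro card_UN_disjoint; auto simp: finite_words_in)
  then show ?thesis by (simp add: card_image)
qed

text \<open>The transfer matrix method with the quotients as states: the entry at \<open>K\<close>
  and \<open>K'\<close> is the number of letters of \<Sigma> that lead from \<open>K\<close> to
  \<open>K'\<close>. Splitting off the first letter gives the linear system.\<close>

lemma C_recursive_card_regular:
  assumes "finite \<Sigma>" "regular L"
  shows "C_recursive (\<lambda>n. int (card (words_in \<Sigma> L n)))"
proof -
  let ?Q = "range (\<lambda>u. lquot u L)"
  have "L = lquot [] L" by simp
  then have L: "L \<in> ?Q" by (rule image_eqI) simp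
  have fin: "finite ?Q" using assms(2) by (simp add: regular_def)
  have "int (card (words_in \<Sigma> K (Suc n))) =
      (\<Sum>K'\<in>?Q. int (card {a \<in> \<Sigma>. lquot [a] K = K'}) * int (card (words_in \<Sigma> K' n)))"
    if "K \<in> ?Q" for K n
  proof -
    have "(\<lambda>a. lquot [a] K) ` \<Sigma> \<subseteq> ?Q" using that by (auto simp: lquot_lquot)
    then have "(\<Sum>a\<in>\<Sigma>. int (card (words_in \<Sigma> (lquot [a] K) n))) =
        (\<Sum>K'\<in>?Q. \<Sum>a | a \<in> \<Sigma> \<and> lquot [a] K = K'. int (card (words_in \<Sigma> (lquot [a] K) n)))"
      by (rule sum.group[OF assms(1) fin, symmetric])
    also have "\<dots> = (\<Sum>K'\<in>?Q. \<Sum>a | a \<in> \<Sigma> \<and> lquot [a] K = K'. int (card (words_in \<Sigma> K' n)))"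
      by (intro sum.cong refl) auto
    finally show ?thesis by (simp add: card_words_in_Suc[OF assms(1)])
  qed
  then show ?thesis by (rule C_recursive_system[OF fin L])
qed

section \<open>From formulas to regular languages\<close>

text \<open>The equivalence makes \<open>xs\<close> an isomorphism from its positions, ordered as
  numbers, onto the ordered set.\<close>

definition enumerates :: "'a list \<Rightarrow> 'a set \<Rightarrow> 'a rel \<Rightarrow> bool" where
  "enumerates xs A l \<longleftrightarrow> distinct xs \<and> set xs = A \<and>
     (\<forall>i<length xs. \<forall>j<length xs. (xs ! i, xs ! j) \<in> l \<longleftrightarrow> i < j)"

lemma ex_sorted_list:
  assumes "finite A" "trans l" "total_on A l"
  shows "\<exists>xs. distinct xs \<and> set xs = A \<and> sorted_wrt (\<lambda>a b. (a, b) \<in> l) xs"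
  using assms(1,3)
proof (induction A rule: finite_induct)
  case empty
  then show ?case by simp
next
  case (insert a A)
  then obtain xs where xs: "distinct xs" "set xs = A" "sorted_wrt (\<lambda>a b. (a, b) \<in> l) xs"
    by (auto simp: total_on_def)
  let ?lo = "filter (\<lambda>b. (b, a) \<in> l) xs" and ?hi = "filter (\<lambda>b. (b, a) \<notin> l) xs"
  have hi: "(a, b) \<in> l" if "b \<in> set ?hi" for b
    using that insert.prems insert.hyps xs(2) by (auto simp: total_on_def)
  \<comment> \<open>Inside each half the order is inherited from \<open>xs\<close>; across the cut
    it follows by transitivity through \<open>a\<close>.\<close>
  have "sorted_wrt (\<lambda>a b. (a, b) \<in> l) (?lo @ a # ?hi)"
    using xs(3) hi by (auto simp: sorted_wrt_append sorted_wrt_filter intro: transD[OF assms(2)])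
  moreover have "distinct (?lo @ a # ?hi)" "set (?lo @ a # ?hi) = insert a A"
    using xs insert.hyps by auto
  ultimately show ?case by blast
qed

lemma enumeration_exists:
  assumes "finite A" "lin_order_of A l"
  obtains xs where "enumerates xs A l"
proof -
  have l: "trans l" "irrefl l" "total_on A l"
    using assms(2) by (auto simp: lin_order_of_def strict_linear_order_on_def)
  obtain xs where xs: "distinct xs" "set xs = A" "sorted_wrt (\<lambda>a b. (a, b) \<in> l) xs"
    using ex_sorted_list[OF assms(1) l(1,3)] by blast
  have "(xs ! i, xs ! j) \<in> l \<longleftrightarrow> i < j" if ij: "i < length xs" "j < length xs" for i j
  proof
    assume *: "(xs ! i, xs ! j) \<in> l"
    show "i < j"
    proof (rule ccontr)
      assume "\<not> i < j"
      then consider "i = j" | "j < i" by linarith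
      then have "(xs ! j, xs ! j) \<in> l"
      proof cases
        case 1
        then show ?thesis using * by simp
      next
        case 2
        then have "(xs ! j, xs ! i) \<in> l" using sorted_wrt_nth_less[OF xs(3)] ij by simp
        then show ?thesis using transD[OF l(1) _ *] by blast
      qed
      then show False using l(2) by (auto simp: irrefl_def)
    qed
  qed (use sorted_wrt_nth_less[OF xs(3)] ij in simp)
  then show ?thesis using that xs unfolding enumerates_def by blast
qed

text \<open>
  A letter records the relation symbols, the element variables and the set variables that
  hold of an element.
\<close>

definition interp_word ::
  "'a list \<Rightarrow> 'a list set list \<Rightarrow> (nat \<Rightarrow> 'a) \<Rightarrow> (nat \<Rightarrow> 'a set) \<Rightarrow> (nat set \<times> nat set \<times> nat set) list"
  where "interp_word xs Rs v V =
    map (\<lambda>a. ({q. q < length Rs \<and> [a] \<in> Rs ! q}, {x. v x = a}, {X. a \<in> V X})) xs"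

text \<open>A guessed track for \<open>x\<close> denotes an element exactly when one and only one
  position is marked, hence the intersection with \<open>occurs\<close> and the complement of
  \<open>occurs_before\<close>. Removing \<open>x\<close> on both sides of the relabelling forgets
  the old value of \<open>x\<close>.\<close>

lemma interp_word_upd1_iff:
  assumes xs: "distinct xs"
  shows "(\<exists>a\<in>set xs. interp_word xs Rs (v(x := a)) V \<in> L) \<longleftrightarrow>
    interp_word xs Rs v V \<in>
      relabel (\<lambda>(r, F, G) (r', F', G'). r = r' \<and> F - {x} = F' - {x} \<and> G = G')
        (L \<inter> (occurs (\<lambda>(r, F, G). x \<in> F) \<inter>
          - occurs_before (\<lambda>(r, F, G). x \<in> F) (\<lambda>(r, F, G). x \<in> F)))"
    (is "?l \<longleftrightarrow> _ \<in> relabel ?R (L \<inter> (occurs ?P \<inter> - occurs_before ?P ?P))")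
proof
  assume ?l
  then obtain a where a: "a \<in> set xs" "interp_word xs Rs (v(x := a)) V \<in> L" by blast
  let ?w = "interp_word xs Rs (v(x := a)) V"
  have "?w \<in> occurs ?P" using a(1) by (auto simp: occurs_iff interp_word_def)
  moreover have "?w \<notin> occurs_before ?P ?P"
    using xs by (auto simp: occurs_before_def interp_word_def nth_eq_iff_index_eq)
  moreover have "list_all2 ?R (interp_word xs Rs v V) ?w"
    by (auto simp: interp_word_def list_all2_conv_all_nth)
  ultimately show "interp_word xs Rs v V \<in> relabel ?R (L \<inter> (occurs ?P \<inter> - occurs_before ?P ?P))"
    using a(2) unfolding relabel_def by blast
next
  assume "interp_word xs Rs v V \<in> relabel ?R (L \<inter> (occurs ?P \<inter> - occurs_before ?P ?P))"
  then obtain w where w: "w \<in> L" "w \<in> occurs ?P" "w \<notin> occurs_before ?P ?P"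
    and R: "list_all2 ?R (interp_word xs Rs v V) w"
    unfolding relabel_def by blast
  from R have len: "length w = length xs"
    by (auto simp: interp_word_def dest: list_all2_lengthD)
  from w(2) obtain i where i: "i < length xs" "?P (w ! i)"
    by (auto simp: occurs_def len)
  have uniq: "?P (w ! j) \<longleftrightarrow> j = i" if "j < length xs" for j
  proof
    assume "?P (w ! j)"
    then have "\<not> i < j" "\<not> j < i"
      using w(3) i that occurs_beforeI[of i j w ?P ?P] occurs_beforeI[of j i w ?P ?P]
      unfolding len by auto
    then show "j = i" by linarith
  qed (use i in simp)
  \<comment> \<open>The guess differs from the original word at most in the track of
    \<open>x\<close>, and this track marks position \<open>i\<close> alone; so the guess is itself
    the word of a valuation.\<close>
  have "w = interp_word xs Rs (v(x := xs ! i)) V"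
  proof (rule nth_equalityI)
    fix j assume "j < length w"
    then have j: "j < length xs" by (simp add: len)
    obtain r F G where wj: "w ! j = (r, F, G)" by (cases "w ! j")
    have "?R (interp_word xs Rs v V ! j) (w ! j)"
      using list_all2_nthD2[OF R] j len by simp
    then have "r = {q. q < length Rs \<and> [xs ! j] \<in> Rs ! q}" "{y. v y = xs ! j} - {x} = F - {x}"
      "G = {X. xs ! j \<in> V X}"
      using j wj by (auto simp: interp_word_def)
    moreover have "x \<in> F \<longleftrightarrow> xs ! i = xs ! j"
      using uniq[OF j] wj i(1) j xs by (auto simp: nth_eq_iff_index_eq)
    ultimately show "w ! j = interp_word xs Rs (v(x := xs ! i)) V ! j"
      using j wj by (auto simp: interp_word_def)
  qed (simp add: len interp_word_def)
  then show ?l using w(1) i(1) by auto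
qed

text \<open>Every marking of the positions is a set of elements, so in contrast to element variables
  nothing restricts the guess.\<close>

lemma interp_word_upd2_iff:
  assumes xs: "distinct xs"
  shows "(\<exists>A. A \<subseteq> set xs \<and> interp_word xs Rs v (V(X := A)) \<in> L) \<longleftrightarrow>
    interp_word xs Rs v V \<in>
      relabel (\<lambda>(r, F, G) (r', F', G'). r = r' \<and> F = F' \<and> G - {X} = G' - {X}) L"
    (is "?l \<longleftrightarrow> _ \<in> relabel ?R L")
proof
  assume ?l
  then obtain A where A: "interp_word xs Rs v (V(X := A)) \<in> L" by blast
  have "list_all2 ?R (interp_word xs Rs v V) (interp_word xs Rs v (V(X := A)))"
    by (auto simp: interp_word_def list_all2_conv_all_nth)
  then show "interp_word xs Rs v V \<in> relabel ?R L"
    using A unfolding relabel_def by blast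
next
  assume "interp_word xs Rs v V \<in> relabel ?R L"
  then obtain w where w: "w \<in> L" and R: "list_all2 ?R (interp_word xs Rs v V) w"
    unfolding relabel_def by blast
  from R have len: "length w = length xs"
    by (auto simp: interp_word_def dest: list_all2_lengthD)
  \<comment> \<open>The set that the track of \<open>X\<close> in the guessed word marks.\<close>
  define A where "A = {xs ! i |i. i < length xs \<and> X \<in> snd (snd (w ! i))}"
  have A: "xs ! j \<in> A \<longleftrightarrow> X \<in> snd (snd (w ! j))" if "j < length xs" for j
    using that xs by (auto simp: A_def nth_eq_iff_index_eq)
  have "w = interp_word xs Rs v (V(X := A))"
  proof (rule nth_equalityI)
    fix j assume "j < length w"
    then have j: "j < length xs" by (simp add: len)
    obtain r F G where wj: "w ! j = (r, F, G)" by (cases "w ! j")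
    have "?R (interp_word xs Rs v V ! j) (w ! j)"
      using list_all2_nthD2[OF R] j len by simp
    then have "r = {q. q < length Rs \<and> [xs ! j] \<in> Rs ! q}" "{y. v y = xs ! j} = F"
      "{X. xs ! j \<in> V X} - {X} = G - {X}"
      using j wj by (auto simp: interp_word_def)
    moreover have "X \<in> G \<longleftrightarrow> xs ! j \<in> A"
      using A[OF j] wj by simp
    ultimately show "w ! j = interp_word xs Rs v (V(X := A)) ! j"
      using j wj by (auto simp: interp_word_def)
  qed (simp add: len interp_word_def)
  moreover have "A \<subseteq> set xs" by (auto simp: A_def)
  ultimately show ?l using w by auto
qed

text \<open>Values inside the universe ensure that each element variable marks exactly one position.
  Fixing the number of relations ensures that the letters record every symbol of the
  vocabulary.\<close>

definition defines_language ::
  "'a itself \<Rightarrow> nat \<Rightarrow> msol \<Rightarrow> (nat set \<times> nat set \<times> nat set) list set \<Rightarrow> bool" where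
  "defines_language _ m \<phi> L \<longleftrightarrow>
     (\<forall>(S :: 'a ostruct) xs v V. enumerates xs (univ S) (ord_rel S) \<longrightarrow> length (rels S) = m \<longrightarrow>
        (\<forall>x. v x \<in> univ S) \<longrightarrow> (sat S v V \<phi> \<longleftrightarrow> interp_word xs (rels S) v V \<in> L))"

text \<open>Arity one enters in the case of \<open>Rel\<close>: such an atom speaks of a single
  position, so it becomes a condition on one letter.\<close>

lemma msol_regular:
  assumes "wf_msol \<rho> \<phi>" "\<forall>r\<in>set \<rho>. r = 1"
  shows "\<exists>L. regular L \<and> defines_language TYPE('a) (length \<rho>) \<phi> L"
  using assms(1)
proof (induction \<phi>)
  case (Eq x y)
  have "defines_language TYPE('a) (length \<rho>) (Eq x y) (occurs (\<lambda>(r, F, G). x \<in> F \<and> y \<in> F))"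
    unfolding defines_language_def by (auto simp: occurs_iff interp_word_def enumerates_def)
  then show ?case using regular_occurs by blast
next
  case (Less x y)
  have "defines_language TYPE('a) (length \<rho>) (Less x y)
      (occurs_before (\<lambda>(r, F, G). x \<in> F) (\<lambda>(r, F, G). y \<in> F))"
    unfolding defines_language_def
  proof (intro allI impI)
    fix S :: "'a ostruct" and xs and v :: "nat \<Rightarrow> 'a" and V
    assume en: "enumerates xs (univ S) (ord_rel S)" and v: "\<forall>x. v x \<in> univ S"
    obtain i j where ij: "i < length xs" "j < length xs" "v x = xs ! i" "v y = xs ! j"
      using en v unfolding enumerates_def by (metis in_set_conv_nth)
    have xs: "distinct xs" using en by (simp add: enumerates_def)
    have "interp_word xs (rels S) v V \<in> occurs_before (\<lambda>(r, F, G). x \<in> F) (\<lambda>(r, F, G). y \<in> F) \<longleftrightarrow>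
        (\<exists>i' j'. i' < j' \<and> j' < length xs \<and> i = i' \<and> j = j')"
      unfolding occurs_before_def
      by (simp add: interp_word_def ij nth_eq_iff_index_eq[OF xs] cong: conj_cong)
    moreover have "(xs ! i, xs ! j) \<in> ord_rel S \<longleftrightarrow> i < j"
      using en ij by (simp add: enumerates_def)
    ultimately show "sat S v V (Less x y) \<longleftrightarrow> interp_word xs (rels S) v V \<in>
        occurs_before (\<lambda>(r, F, G). x \<in> F) (\<lambda>(r, F, G). y \<in> F)"
      using ij by auto
  qed
  then show ?case using regular_occurs_before by blast
next
  case (Rel i ys)
  then have i: "i < length \<rho>" "length ys = Suc 0" using assms(2) by auto
  then obtain x where "ys = [x]" by (auto simp: length_Suc_conv)
  then have "defines_language TYPE('a) (length \<rho>) (Rel i ys) (occurs (\<lambda>(r, F, G). x \<in> F \<and> i \<in> r))"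
    using i unfolding defines_language_def by (auto simp: occurs_iff interp_word_def enumerates_def)
  then show ?case using regular_occurs by blast
next
  case (Mem x X)
  have "defines_language TYPE('a) (length \<rho>) (Mem x X) (occurs (\<lambda>(r, F, G). x \<in> F \<and> X \<in> G))"
    unfolding defines_language_def by (auto simp: occurs_iff interp_word_def enumerates_def)
  then show ?case using regular_occurs by blast
next
  case (Neg \<phi>)
  then obtain L where "regular L" "defines_language TYPE('a) (length \<rho>) \<phi> L" by auto
  then have "regular (- L)" "defines_language TYPE('a) (length \<rho>) (Neg \<phi>) (- L)"
    by (auto simp: defines_language_def regular_Compl)
  then show ?case by blast
next
  case (Conj \<phi> \<psi>)
  then obtain L K where "regular L" "defines_language TYPE('a) (length \<rho>) \<phi> L"
    "regular K" "defines_language TYPE('a) (length \<rho>) \<psi> K" by auto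
  then have "regular (L \<inter> K)" "defines_language TYPE('a) (length \<rho>) (Conj \<phi> \<psi>) (L \<inter> K)"
    by (auto simp: defines_language_def regular_Int)
  then show ?case by blast
next
  case (Ex1 x \<phi>)
  then obtain L where L: "regular L" "defines_language TYPE('a) (length \<rho>) \<phi> L" by auto
  define L' where "L' = relabel (\<lambda>(r, F, G) (r', F', G'). r = r' \<and> F - {x} = F' - {x} \<and> G = G')
        (L \<inter> (occurs (\<lambda>(r, F, G). x \<in> F) \<inter>
          - occurs_before (\<lambda>(r :: nat set, F, G :: nat set). x \<in> F) (\<lambda>(r, F, G). x \<in> F)))"
  have "regular L'"
    unfolding L'_def
    by (intro regular_relabel regular_Int regular_Compl L regular_occurs regular_occurs_before)
  moreover have "defines_language TYPE('a) (length \<rho>) (Ex1 x \<phi>) L'"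
    unfolding defines_language_def
  proof (intro allI impI)
    fix S :: "'a ostruct" and xs and v :: "nat \<Rightarrow> 'a" and V
    assume en: "enumerates xs (univ S) (ord_rel S)" and m: "length (rels S) = length \<rho>"
      and v: "\<forall>x. v x \<in> univ S"
    have xs: "distinct xs" "set xs = univ S" using en by (auto simp: enumerates_def)
    have "sat S (v(x := a)) V \<phi> \<longleftrightarrow> interp_word xs (rels S) (v(x := a)) V \<in> L"
      if "a \<in> univ S" for a
      using L(2) en m v that unfolding defines_language_def by simp
    then show "sat S v V (Ex1 x \<phi>) \<longleftrightarrow> interp_word xs (rels S) v V \<in> L'"
      using interp_word_upd1_iff[OF xs(1), of "rels S" v x V L] unfolding L'_def xs(2) by simp
  qed
  ultimately show ?case by blast
next
  case (Ex2 X \<phi>)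
  then obtain L where L: "regular L" "defines_language TYPE('a) (length \<rho>) \<phi> L" by auto
  define L' where
    "L' = relabel (\<lambda>(r, F, G) (r', F', G'). r = r' \<and> F = F' \<and> G - {X} = G' - {X}) L"
  have "regular L'"
    unfolding L'_def by (intro regular_relabel L)
  moreover have "defines_language TYPE('a) (length \<rho>) (Ex2 X \<phi>) L'"
    unfolding defines_language_def
  proof (intro allI impI)
    fix S :: "'a ostruct" and xs and v :: "nat \<Rightarrow> 'a" and V
    assume en: "enumerates xs (univ S) (ord_rel S)" and m: "length (rels S) = length \<rho>"
      and v: "\<forall>x. v x \<in> univ S"
    have xs: "distinct xs" "set xs = univ S" using en by (auto simp: enumerates_def)
    have "sat S v (V(X := A)) \<phi> \<longleftrightarrow> interp_word xs (rels S) v (V(X := A)) \<in> L" for A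
      using L(2) en m v unfolding defines_language_def by simp
    then show "sat S v V (Ex2 X \<phi>) \<longleftrightarrow> interp_word xs (rels S) v V \<in> L'"
      using interp_word_upd2_iff[OF xs(1), of "rels S" v V X L] unfolding L'_def xs(2) by simp
  qed
  ultimately show ?case by blast
qed

section \<open>Sentences, and structures as words over a finite alphabet\<close>

lemma sat_cong:
  assumes "\<And>x. x \<in> fv1 \<phi> \<Longrightarrow> v x = v' x" "\<And>X. X \<in> fv2 \<phi> \<Longrightarrow> V X = V' X"
  shows "sat S v V \<phi> \<longleftrightarrow> sat S v' V' \<phi>"
  using assms
proof (induction \<phi> arbitrary: v v' V V')
  case (Rel i xs)
  then have "map v xs = map v' xs" by simp
  then show ?case by (simp del: map_eq_conv)
next
  case (Neg \<phi>)
  then show ?case by (metis fv1.simps(5) fv2.simps(5) sat.simps(5))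
next
  case (Conj \<phi> \<psi>)
  have "sat S v V \<phi> \<longleftrightarrow> sat S v' V' \<phi>" by (rule Conj.IH) (use Conj.prems in auto)
  moreover have "sat S v V \<psi> \<longleftrightarrow> sat S v' V' \<psi>" by (rule Conj.IH) (use Conj.prems in auto)
  ultimately show ?case by simp
next
  case (Ex1 x \<phi>)
  have "sat S (v(x := a)) V \<phi> \<longleftrightarrow> sat S (v'(x := a)) V' \<phi>" for a
    by (rule Ex1.IH) (use Ex1.prems in auto)
  then show ?case by simp
next
  case (Ex2 X \<phi>)
  have "sat S v (V(X := A)) \<phi> \<longleftrightarrow> sat S v' (V'(X := A)) \<phi>" for A
    by (rule Ex2.IH) (use Ex2.prems in auto)
  then show ?case by simp
qed auto

text \<open>A sentence has the same truth value under all valuations, and \<open>a\<close> provides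
  one inside the universe, so the quantification in \<open>models\<close> is not vacuous.\<close>

lemma models_iff_sat:
  fixes S :: "'a ostruct"
  assumes "msol_sentence \<rho> \<phi>" "a \<in> univ S"
  shows "models S \<phi> \<longleftrightarrow> sat S (\<lambda>_. a) (\<lambda>_. {}) \<phi>"
proof -
  have "sat S v V \<phi> \<longleftrightarrow> sat S (\<lambda>_. a) (\<lambda>_. {}) \<phi>" for v V
    by (rule sat_cong) (use assms(1) in \<open>auto simp: msol_sentence_def\<close>)
  then have "models S \<phi> \<longleftrightarrow> (\<forall>v :: nat \<Rightarrow> 'a. \<forall>V. (\<forall>x. v x \<in> univ S) \<longrightarrow> (\<forall>X :: nat. V X \<subseteq> univ S) \<longrightarrow>
      sat S (\<lambda>_. a) (\<lambda>_. {}) \<phi>)"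
    unfolding models_def by blast
  moreover have "\<exists>v :: nat \<Rightarrow> 'a. \<forall>x. v x \<in> univ S" "\<exists>V :: nat \<Rightarrow> 'a set. \<forall>X. V X \<subseteq> univ S"
    using assms(2) by (auto intro!: exI[of _ "\<lambda>_. a"] exI[of _ "\<lambda>_. {}"])
  ultimately show ?thesis by blast
qed

definition rel_word :: "'a list \<Rightarrow> 'a list set list \<Rightarrow> nat set list" where
  "rel_word xs Rs = map (\<lambda>a. {q. q < length Rs \<and> [a] \<in> Rs ! q}) xs"

text \<open>A tuple of unary relations is the same as a free choice, at each element, of the set of
  symbols that hold there. This makes the alphabet \<open>Pow {..<length \<rho>}\<close>, which is
  finite.\<close>

lemma bij_betw_rel_word:
  assumes \<rho>: "\<forall>r\<in>set \<rho>. r = 1" and xs: "distinct xs"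
  shows "bij_betw (rel_word xs) {Rs. rel_interp \<rho> (set xs) Rs}
    {w. length w = length xs \<and> set w \<subseteq> Pow {..<length \<rho>}}"
proof -
  define dec where "dec = (\<lambda>w. map (\<lambda>q. {[xs ! i] |i. i < length xs \<and> q \<in> w ! i}) [0..<length \<rho>])"
  have \<rho>1: "\<rho> ! q = Suc 0" if "q < length \<rho>" for q using \<rho> that by (metis One_nat_def nth_mem)
  have interp: "rel_interp \<rho> (set xs) Rs \<longleftrightarrow> length Rs = length \<rho> \<and>
      (\<forall>q<length \<rho>. Rs ! q \<subseteq> {ys. set ys \<subseteq> set xs \<and> length ys = Suc 0})" for Rs
    by (auto simp: rel_interp_def list_all2_conv_all_nth \<rho>1 simp del: mem_Collect_eq)
  show ?thesis
  proof (rule bij_betw_byWitness[where f' = dec])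
    show "rel_word xs ` {Rs. rel_interp \<rho> (set xs) Rs} \<subseteq>
        {w. length w = length xs \<and> set w \<subseteq> Pow {..<length \<rho>}}"
      by (auto simp: rel_word_def interp)
    show "dec ` {w. length w = length xs \<and> set w \<subseteq> Pow {..<length \<rho>}} \<subseteq>
        {Rs. rel_interp \<rho> (set xs) Rs}"
      by (auto simp: dec_def interp)
  next
    show "\<forall>Rs\<in>{Rs. rel_interp \<rho> (set xs) Rs}. dec (rel_word xs Rs) = Rs"
    proof
      fix Rs assume "Rs \<in> {Rs. rel_interp \<rho> (set xs) Rs}"
      then have len: "length Rs = length \<rho>"
        and sub: "\<And>q. q < length \<rho> \<Longrightarrow> Rs ! q \<subseteq> {ys. set ys \<subseteq> set xs \<and> length ys = Suc 0}"
        by (auto simp: interp)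
      show "dec (rel_word xs Rs) = Rs"
      proof (rule nth_equalityI)
        fix q assume "q < length (dec (rel_word xs Rs))"
        then have q: "q < length \<rho>" by (simp add: dec_def)
        have "dec (rel_word xs Rs) ! q = {[xs ! i] |i. i < length xs \<and> [xs ! i] \<in> Rs ! q}"
          using q len by (auto simp: dec_def rel_word_def)
        also have "\<dots> = Rs ! q"
        proof (intro equalityI subsetI)
          fix ys assume ys: "ys \<in> Rs ! q"
          then obtain a where "ys = [a]" "a \<in> set xs"
            using sub[OF q] by (auto simp: length_Suc_conv)
          then show "ys \<in> {[xs ! i] |i. i < length xs \<and> [xs ! i] \<in> Rs ! q}"
            using ys by (auto simp: in_set_conv_nth)
        qed auto
        finally show "dec (rel_word xs Rs) ! q = Rs ! q" .
      qed (simp add: dec_def len)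
    qed
  next
    show "\<forall>w\<in>{w. length w = length xs \<and> set w \<subseteq> Pow {..<length \<rho>}}. rel_word xs (dec w) = w"
    proof
      fix w assume "w \<in> {w. length w = length xs \<and> set w \<subseteq> Pow {..<length \<rho>}}"
      then have w: "length w = length xs" "set w \<subseteq> Pow {..<length \<rho>}" by auto
      show "rel_word xs (dec w) = w"
      proof (rule nth_equalityI)
        fix i assume "i < length (rel_word xs (dec w))"
        then have i: "i < length xs" by (simp add: rel_word_def)
        have "q < length \<rho>" if "q \<in> w ! i" for q
          using that w i by (metis PowD lessThan_iff nth_mem subsetD)
        then show "rel_word xs (dec w) ! i = w ! i"
          using i xs by (auto simp: rel_word_def dec_def nth_eq_iff_index_eq)
      qed (simp add: rel_word_def w)
    qed
  qed
qed

text \<open>The right-hand side does not mention \<open>l\<close>: if the same property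
  \<open>P\<close> of words describes membership in \<open>D\<close> for every order, then the count
  is order invariant.\<close>

lemma osp_eq_card_words:
  assumes \<rho>: "\<forall>r\<in>set \<rho>. r = 1" and xs: "distinct xs" "set xs = {1..n}"
    and D: "\<And>Rs. rel_interp \<rho> {1..n} Rs \<Longrightarrow>
      \<lparr>univ = {1..n}, ord_rel = l, rels = Rs\<rparr> \<in> D \<longleftrightarrow> P (rel_word xs Rs)"
  shows "osp \<rho> D n l = card {w. length w = n \<and> set w \<subseteq> Pow {..<length \<rho>} \<and> P w}"
proof -
  have len: "length xs = n" using distinct_card[OF xs(1)] xs(2) by simp
  note bij = bij_betw_rel_word[OF \<rho> xs(1), unfolded xs(2) len]
  have "{Rs. rel_interp \<rho> {1..n} Rs \<and> \<lparr>univ = {1..n}, ord_rel = l, rels = Rs\<rparr> \<in> D} =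
      {Rs \<in> {Rs. rel_interp \<rho> {1..n} Rs}. P (rel_word xs Rs)}"
    using D by auto
  moreover have "bij_betw (rel_word xs) {Rs \<in> {Rs. rel_interp \<rho> {1..n} Rs}. P (rel_word xs Rs)}
      {w \<in> {w. length w = n \<and> set w \<subseteq> Pow {..<length \<rho>}}. P w}"
    using bij unfolding bij_betw_def inj_on_def by (auto simp: image_iff) blast+
  ultimately show ?thesis
    unfolding osp_def using bij_betw_same_card by fastforce
qed

text \<open>
  The truth of a sentence does not depend on the valuation, so every element variable may denote
  the first element and every set variable the empty set.
\<close>

definition mark_first :: "nat set list \<Rightarrow> (nat set \<times> nat set \<times> nat set) list" where
  "mark_first w = (case w of [] \<Rightarrow> [] | r # w' \<Rightarrow> (r, UNIV, {}) # map (\<lambda>r. (r, {}, {})) w')"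

text \<open>Behind a nonempty prefix \<open>u\<close> the marking acts letter by letter, so the
  quotient depends only on the quotient of \<open>L\<close> by \<open>mark_first u\<close>. The
  empty prefix contributes one further language.\<close>

lemma regular_vimage_mark_first:
  assumes "regular L"
  shows "regular {w. mark_first w \<in> L}"
proof (rule regularI)
  let ?F = "insert {w. mark_first w \<in> L} ((\<lambda>K. {v. map (\<lambda>r. (r, {}, {})) v \<in> K}) ` range (\<lambda>u. lquot u L))"
  show "finite ?F" using assms by (simp add: regular_def)
  show "lquot u {w. mark_first w \<in> L} \<in> ?F" for u
  proof (cases u)
    case (Cons r u')
    then have "lquot u {w. mark_first w \<in> L} =
        {v. map (\<lambda>r. (r, {}, {})) v \<in> lquot (mark_first u) L}"
      by (auto simp: mark_first_def)
    then show ?thesis by blast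
  qed simp
qed

lemma interp_word_eq_mark_first:
  assumes "distinct xs" "xs \<noteq> []"
  shows "interp_word xs Rs (\<lambda>_. hd xs) (\<lambda>_. {}) = mark_first (rel_word xs Rs)"
  using assms by (cases xs) (auto simp: interp_word_def rel_word_def mark_first_def)

text \<open>A separate sequence \<open>g\<close> appears because \<open>f 0\<close> is arbitrary,
  whereas \<open>C_recursive\<close> constrains the value at 0 as well.\<close>

lemma C_recursive_specker:
  assumes "counting_order_invariant_msol_specker 1 f"
  obtains g where "C_recursive g" "\<And>n. n \<ge> 1 \<Longrightarrow> int (f n) = g n"
proof -
  obtain \<rho> D where \<rho>: "\<forall>r\<in>set \<rho>. 1 \<le> r \<and> r \<le> 1" and "msol_definable \<rho> D"
    and inv: "\<And>n l. n \<ge> 1 \<Longrightarrow> lin_order_of {1..n} l \<Longrightarrow> f n = osp \<rho> D n l"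
    using assms unfolding counting_order_invariant_msol_specker_def by blast
  then obtain \<phi> where \<phi>: "msol_sentence \<rho> \<phi>"
    and D: "\<And>S. ordered_structure \<rho> S \<Longrightarrow> S \<in> D \<longleftrightarrow> models S \<phi>"
    unfolding msol_definable_def by blast
  have \<rho>1: "\<forall>r\<in>set \<rho>. r = 1" using \<rho> by auto
  obtain L where L: "regular L" "defines_language TYPE(nat) (length \<rho>) \<phi> L"
    using msol_regular[OF _ \<rho>1] \<phi> unfolding msol_sentence_def by blast
  define L' where "L' = {w. mark_first w \<in> L}"
  have "int (f n) = int (card (words_in (Pow {..<length \<rho>}) L' n))" if n: "n \<ge> 1" for n
  proof -
    define l where "l = {(i, j). i \<in> {1..n} \<and> j \<in> {1..n} \<and> i < j}"
    have l: "lin_order_of {1..n} l"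
      unfolding lin_order_of_def strict_linear_order_on_def l_def
      by (auto simp: trans_def irrefl_def total_on_def)
    obtain xs where xs: "enumerates xs {1..n} l" using enumeration_exists[OF _ l] by auto
    then have set: "distinct xs" "set xs = {1..n}" by (auto simp: enumerates_def)
    then have ne: "xs \<noteq> []" using n by auto
    then have hd: "hd xs \<in> {1..n}" using hd_in_set set(2) by blast
    have "\<lparr>univ = {1..n}, ord_rel = l, rels = Rs\<rparr> \<in> D \<longleftrightarrow> rel_word xs Rs \<in> L'"
      if Rs: "rel_interp \<rho> {1..n} Rs" for Rs
    proof -
      let ?S = "\<lparr>univ = {1..n}, ord_rel = l, rels = Rs\<rparr>"
      have "length Rs = length \<rho>" using Rs by (auto simp: rel_interp_def dest: list_all2_lengthD)
      then have "sat ?S (\<lambda>_. hd xs) (\<lambda>_. {}) \<phi> \<longleftrightarrow> mark_first (rel_word xs Rs) \<in> L"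
        using L(2) xs hd interp_word_eq_mark_first[OF set(1) ne, of Rs]
        unfolding defines_language_def by simp
      moreover have "ordered_structure \<rho> ?S" using Rs l n by (simp add: ordered_structure_def)
      ultimately show ?thesis
        using D models_iff_sat[OF \<phi>, of "hd xs" ?S] hd by (simp add: L'_def)
    qed
    then show ?thesis
      using osp_eq_card_words[OF \<rho>1 set, of l D "\<lambda>w. w \<in> L'"] inv[OF n l] by (simp add: words_in_def)
  qed
  moreover have "C_recursive (\<lambda>n. int (card (words_in (Pow {..<length \<rho>}) L' n)))"
    unfolding L'_def by (intro C_recursive_card_regular regular_vimage_mark_first L) simp
  ultimately show ?thesis using that by blast
qed

section \<open>Walks in finite digraphs\<close>

definition Disj :: "msol \<Rightarrow> msol \<Rightarrow> msol" where
  "Disj \<phi> \<psi> = Neg (Conj (Neg \<phi>) (Neg \<psi>))"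

definition All1 :: "nat \<Rightarrow> msol \<Rightarrow> msol" where
  "All1 x \<phi> = Neg (Ex1 x (Neg \<phi>))"

text \<open>The empty disjunction has to be a closed formula, lest it add free variables to a
  sentence.\<close>

definition FF :: msol where
  "FF = Ex1 0 (Neg (Eq 0 0))"

definition Disjs :: "msol list \<Rightarrow> msol" where
  "Disjs \<phi>s = foldr Disj \<phi>s FF"

lemma sat_derived [simp]:
  "sat S v V (Disj \<phi> \<psi>) \<longleftrightarrow> sat S v V \<phi> \<or> sat S v V \<psi>"
  "sat S v V (All1 x \<phi>) \<longleftrightarrow> (\<forall>a\<in>univ S. sat S (v(x := a)) V \<phi>)"
  "sat S v V (Disjs \<phi>s) \<longleftrightarrow> (\<exists>\<phi>\<in>set \<phi>s. sat S v V \<phi>)"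
proof -
  show "sat S v V (Disjs \<phi>s) \<longleftrightarrow> (\<exists>\<phi>\<in>set \<phi>s. sat S v V \<phi>)"
    by (induction \<phi>s) (auto simp: Disjs_def Disj_def FF_def)
qed (simp_all add: Disj_def All1_def)

lemma sat_Disjs_map:
  "sat S v V (Disjs (map \<phi> [0..<m])) \<longleftrightarrow> (\<exists>q<m. sat S v V (\<phi> q))"
  "sat S v V (Disjs (map \<phi> (filter P [0..<m]))) \<longleftrightarrow> (\<exists>q<m. P q \<and> sat S v V (\<phi> q))"
  "sat S v V (Disjs (map (\<lambda>(q, q'). \<psi> q q')
      (filter (\<lambda>(q, q'). R q q') (List.product [0..<m] [0..<m])))) \<longleftrightarrow>
    (\<exists>q<m. \<exists>q'<m. R q q' \<and> sat S v V (\<psi> q q'))"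
  by auto

lemma wf_msol_derived [simp]:
  "wf_msol \<rho> (Disj \<phi> \<psi>) \<longleftrightarrow> wf_msol \<rho> \<phi> \<and> wf_msol \<rho> \<psi>"
  "wf_msol \<rho> (All1 x \<phi>) \<longleftrightarrow> wf_msol \<rho> \<phi>"
  "wf_msol \<rho> (Disjs \<phi>s) \<longleftrightarrow> (\<forall>\<phi>\<in>set \<phi>s. wf_msol \<rho> \<phi>)"
proof -
  show "wf_msol \<rho> (Disjs \<phi>s) \<longleftrightarrow> (\<forall>\<phi>\<in>set \<phi>s. wf_msol \<rho> \<phi>)"
    by (induction \<phi>s) (auto simp: Disjs_def Disj_def FF_def)
qed (simp_all add: Disj_def All1_def)

lemma fv1_derived [simp]:
  "fv1 (Disj \<phi> \<psi>) = fv1 \<phi> \<union> fv1 \<psi>"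
  "fv1 (All1 x \<phi>) = fv1 \<phi> - {x}"
  "fv1 (Disjs \<phi>s) = (\<Union>\<phi>\<in>set \<phi>s. fv1 \<phi>)"
proof -
  show "fv1 (Disjs \<phi>s) = (\<Union>\<phi>\<in>set \<phi>s. fv1 \<phi>)"
    by (induction \<phi>s) (auto simp: Disjs_def Disj_def FF_def)
qed (simp_all add: Disj_def All1_def)

lemma fv2_derived [simp]:
  "fv2 (Disj \<phi> \<psi>) = fv2 \<phi> \<union> fv2 \<psi>"
  "fv2 (All1 x \<phi>) = fv2 \<phi>"
  "fv2 (Disjs \<phi>s) = (\<Union>\<phi>\<in>set \<phi>s. fv2 \<phi>)"
proof -
  show "fv2 (Disjs \<phi>s) = (\<Union>\<phi>\<in>set \<phi>s. fv2 \<phi>)"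
    by (induction \<phi>s) (auto simp: Disjs_def Disj_def FF_def)
qed (simp_all add: Disj_def All1_def)

text \<open>The relations of a structure may overlap or leave gaps, so it must be stated that a
  position carries exactly one state.\<close>

definition Only :: "nat \<Rightarrow> nat \<Rightarrow> nat \<Rightarrow> msol" where
  "Only m q x = Conj (Rel q [x]) (Neg (Disjs (map (\<lambda>q'. Rel q' [x]) (filter (\<lambda>q'. q' \<noteq> q) [0..<m]))))"

lemma Only_simps [simp]:
  "fv1 (Only m q x) = {x}" "fv2 (Only m q x) = {}"
  "wf_msol \<rho> (Only m q x) \<longleftrightarrow> q < length \<rho> \<and> \<rho> ! q = 1 \<and> (\<forall>q'<m. q' < length \<rho> \<and> \<rho> ! q' = 1)"
  by (auto simp: Only_def)

lemma sat_Only: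
  assumes "length (rels S) = m" "q < m"
  shows "sat S v V (Only m q x) \<longleftrightarrow> {q'. q' < length (rels S) \<and> [v x] \<in> rels S ! q'} = {q}"
  using assms by (auto simp: Only_def)

text \<open>Here \<open>n\<close> counts vertices and not edges, to match the size of the universe.
  Nonemptiness gives \<open>hd\<close> and \<open>last\<close> their meaning.\<close>

definition walks :: "'q set \<Rightarrow> ('q \<Rightarrow> bool) \<Rightarrow> ('q \<Rightarrow> 'q \<Rightarrow> bool) \<Rightarrow> nat \<Rightarrow> 'q list set" where
  "walks Q I E n = {qs. length qs = n \<and> set qs \<subseteq> Q \<and> qs \<noteq> [] \<and> I (hd qs) \<and> successively E qs}"

lemma finite_walks: "finite Q \<Longrightarrow> finite (walks Q I E n)"
  unfolding walks_def by (rule finite_subset[OF _ finite_lists_length_eq[of Q n]]) auto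

text \<open>Positions are accessible through the order alone: the first one has nothing below it,
  the last one nothing above it, and neighbours are comparable elements with nothing between
  them.\<close>

definition Walk_formula ::
  "nat \<Rightarrow> (nat \<Rightarrow> bool) \<Rightarrow> (nat \<Rightarrow> bool) \<Rightarrow> (nat \<Rightarrow> nat \<Rightarrow> bool) \<Rightarrow> msol" where
  "Walk_formula m I F E =
    Conj (All1 0 (Disjs (map (\<lambda>q. Only m q 0) [0..<m])))
   (Conj (All1 0 (Disj (Ex1 1 (Less 1 0)) (Disjs (map (\<lambda>q. Only m q 0) (filter I [0..<m])))))
   (Conj (All1 0 (Disj (Ex1 1 (Less 0 1)) (Disjs (map (\<lambda>q. Only m q 0) (filter F [0..<m])))))
     (All1 0 (All1 1 (Disj (Neg (Less 0 1)) (Disj (Ex1 2 (Conj (Less 0 2) (Less 2 1)))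
       (Disjs (map (\<lambda>(q, q'). Conj (Only m q 0) (Only m q' 1))
         (filter (\<lambda>(q, q'). E q q') (List.product [0..<m] [0..<m]))))))))))"

lemma msol_sentence_Walk_formula: "msol_sentence (replicate m 1) (Walk_formula m I F E)"
  by (auto simp: msol_sentence_def Walk_formula_def)

definition walk_word :: "nat \<Rightarrow> (nat \<Rightarrow> bool) \<Rightarrow> (nat \<Rightarrow> bool) \<Rightarrow> (nat \<Rightarrow> nat \<Rightarrow> bool) \<Rightarrow> nat set list \<Rightarrow> bool"
  where "walk_word m I F E w \<longleftrightarrow> w \<noteq> [] \<and>
    (\<forall>i<length w. \<exists>q<m. w ! i = {q}) \<and> (\<exists>q<m. I q \<and> hd w = {q}) \<and> (\<exists>q<m. F q \<and> last w = {q}) \<and>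
    (\<forall>i. Suc i < length w \<longrightarrow> (\<exists>q<m. \<exists>q'<m. E q q' \<and> w ! i = {q} \<and> w ! Suc i = {q'}))"

lemma all_first_iff: "n > 0 \<Longrightarrow> (\<forall>i<n. 0 < i \<or> P i) \<longleftrightarrow> P (0 :: nat)"
  by (metis gr0I less_irrefl)

lemma all_last_iff:
  assumes "n > 0"
  shows "(\<forall>i<n. Suc i < n \<or> P i) \<longleftrightarrow> P (n - 1)"
proof
  assume *: "P (n - 1)"
  have "i = n - 1" if "i < n" "\<not> Suc i < n" for i using that by simp
  then show "\<forall>i<n. Suc i < n \<or> P i" using * by blast
qed (use assms in \<open>auto dest: spec[of _ "n - 1"]\<close>)

lemma all_successive_iff:
  "(\<forall>i<n. \<forall>j<n. \<not> i < j \<or> Suc i < j \<or> P i j) \<longleftrightarrow> (\<forall>i. Suc i < n \<longrightarrow> P i (Suc i))"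
proof (intro iffI allI impI)
  fix i assume *: "\<forall>i<n. \<forall>j<n. \<not> i < j \<or> Suc i < j \<or> P i j" and i: "Suc i < n"
  have "\<not> i < Suc i \<or> Suc i < Suc i \<or> P i (Suc i)"
    using i by (intro *[rule_format]) simp_all
  then show "P i (Suc i)" by simp
next
  fix i j assume *: "\<forall>i. Suc i < n \<longrightarrow> P i (Suc i)" and j: "j < n"
  consider "\<not> i < j" | "Suc i < j" | "j = Suc i" by linarith
  then show "\<not> i < j \<or> Suc i < j \<or> P i j"
  proof cases
    case 3
    then show ?thesis using *[rule_format, of i] j by simp
  qed simp_all
qed

lemma models_Walk_formula:
  assumes en: "enumerates xs (univ S) (ord_rel S)" and "xs \<noteq> []" and m: "length (rels S) = m"
  shows "models S (Walk_formula m I F E) \<longleftrightarrow> walk_word m I F E (rel_word xs (rels S))"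
proof -
  let ?w = "rel_word xs (rels S)" and ?n = "length xs"
  have xs: "distinct xs" "set xs = univ S"
    and less: "\<And>i j. i < ?n \<Longrightarrow> j < ?n \<Longrightarrow> (xs ! i, xs ! j) \<in> ord_rel S \<longleftrightarrow> i < j"
    using en by (auto simp: enumerates_def)
  have all: "(\<forall>a\<in>univ S. P a) \<longleftrightarrow> (\<forall>i<?n. P (xs ! i))" for P
    unfolding xs(2)[symmetric] by (simp add: all_set_conv_all_nth)
  have ex: "(\<exists>a\<in>univ S. P a) \<longleftrightarrow> (\<exists>i<?n. P (xs ! i))" for P
    using all[of "\<lambda>a. \<not> P a"] by blast
  \<comment> \<open>The second form reads a variable below a later assignment to another one, as
    needed when an edge is described with variables 0 and 1.\<close>
  have only: "sat S (v(x := xs ! i)) V (Only m q x) \<longleftrightarrow> ?w ! i = {q}"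
    "x \<noteq> y \<Longrightarrow> sat S (v(x := xs ! i, y := a)) V (Only m q x) \<longleftrightarrow> ?w ! i = {q}"
    if "i < ?n" "q < m" for v V q x y i a
    using that by (simp_all add: sat_Only[OF m] rel_word_def)
  have n: "?n > 0" using \<open>xs \<noteq> []\<close> by simp
  have len: "length ?w = ?n" by (simp add: rel_word_def)
  have ne: "?w \<noteq> []" using \<open>xs \<noteq> []\<close> by (simp add: rel_word_def)
  have hd: "hd ?w = ?w ! 0" and last: "last ?w = ?w ! (?n - 1)"
    using hd_conv_nth[OF ne] last_conv_nth[OF ne] len by simp_all
  have first: "(\<exists>a\<in>univ S. (a, xs ! i) \<in> ord_rel S) \<longleftrightarrow> 0 < i" if "i < ?n" for i
  proof -
    have "(\<exists>a\<in>univ S. (a, xs ! i) \<in> ord_rel S) \<longleftrightarrow> (\<exists>j<?n. j < i)"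
      unfolding ex by (simp add: less that cong: conj_cong)
    then show ?thesis using n by auto
  qed
  have final: "(\<exists>a\<in>univ S. (xs ! i, a) \<in> ord_rel S) \<longleftrightarrow> Suc i < ?n" if "i < ?n" for i
  proof -
    have "(\<exists>a\<in>univ S. (xs ! i, a) \<in> ord_rel S) \<longleftrightarrow> (\<exists>j<?n. i < j)"
      unfolding ex by (simp add: less that cong: conj_cong)
    then show ?thesis by (metis lessI less_trans_Suc)
  qed
  have between: "(\<exists>a\<in>univ S. (xs ! i, a) \<in> ord_rel S \<and> (a, xs ! j) \<in> ord_rel S) \<longleftrightarrow> Suc i < j"
    if "i < ?n" "j < ?n" for i j
  proof -
    have "(\<exists>k<?n. (xs ! i, xs ! k) \<in> ord_rel S \<and> (xs ! k, xs ! j) \<in> ord_rel S) \<longleftrightarrow>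
        (\<exists>k<?n. i < k \<and> k < j)"
      by (simp add: less that cong: conj_cong)
    then show ?thesis unfolding ex using that by (auto intro!: exI[of _ "Suc i"])
  qed
  have letter: "sat S (v(0 := xs ! i)) V (Disjs (map (\<lambda>q. Only m q 0) [0..<m])) \<longleftrightarrow>
      (\<exists>q<m. ?w ! i = {q})"
    "sat S (v(0 := xs ! i)) V (Disjs (map (\<lambda>q. Only m q 0) (filter P [0..<m]))) \<longleftrightarrow>
      (\<exists>q<m. P q \<and> ?w ! i = {q})"
    if "i < ?n" for v V i P
    using that unfolding sat_Disjs_map by (simp_all add: only cong: conj_cong)
  have letters: "sat S (v(0 := xs ! i, Suc 0 := xs ! j)) V
      (Disjs (map (\<lambda>(q, q'). Conj (Only m q 0) (Only m q' (Suc 0)))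
        (filter (\<lambda>(q, q'). R q q') (List.product [0..<m] [0..<m])))) \<longleftrightarrow>
      (\<exists>q<m. \<exists>q'<m. R q q' \<and> ?w ! i = {q} \<and> ?w ! j = {q'})"
    if "i < ?n" "j < ?n" for v V i j R
    using that unfolding sat_Disjs_map by (simp_all add: only cong: conj_cong)
  have sat_iff: "sat S v V (Walk_formula m I F E) \<longleftrightarrow>
      (\<forall>i<?n. \<exists>q<m. ?w ! i = {q}) \<and>
      (\<forall>i<?n. 0 < i \<or> (\<exists>q<m. I q \<and> ?w ! i = {q})) \<and>
      (\<forall>i<?n. Suc i < ?n \<or> (\<exists>q<m. F q \<and> ?w ! i = {q})) \<and>
      (\<forall>i<?n. \<forall>j<?n. \<not> i < j \<or> Suc i < j \<or> (\<exists>q<m. \<exists>q'<m. E q q' \<and> ?w ! i = {q} \<and> ?w ! j = {q'}))"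
    (is "_ \<longleftrightarrow> ?rhs") for v V
  proof -
    have start: "sat S (v(0 := xs ! i)) V
        (Disj (Ex1 1 (Less 1 0)) (Disjs (map (\<lambda>q. Only m q 0) (filter I [0..<m])))) \<longleftrightarrow>
        0 < i \<or> (\<exists>q<m. I q \<and> ?w ! i = {q})" if "i < ?n" for i
      using that by (simp add: first letter del: sat_derived(3))
    have stop: "sat S (v(0 := xs ! i)) V
        (Disj (Ex1 1 (Less 0 1)) (Disjs (map (\<lambda>q. Only m q 0) (filter F [0..<m])))) \<longleftrightarrow>
        Suc i < ?n \<or> (\<exists>q<m. F q \<and> ?w ! i = {q})" if "i < ?n" for i
      using that by (simp add: final letter del: sat_derived(3))
    have edge: "sat S (v(0 := xs ! i, 1 := xs ! j)) V
        (Disj (Neg (Less 0 1)) (Disj (Ex1 2 (Conj (Less 0 2) (Less 2 1)))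
          (Disjs (map (\<lambda>(q, q'). Conj (Only m q 0) (Only m q' 1))
            (filter (\<lambda>(q, q'). E q q') (List.product [0..<m] [0..<m])))))) \<longleftrightarrow>
        \<not> i < j \<or> Suc i < j \<or> (\<exists>q<m. \<exists>q'<m. E q q' \<and> ?w ! i = {q} \<and> ?w ! j = {q'})"
      if "i < ?n" "j < ?n" for i j
      using that by (simp add: less between letters del: sat_derived(3))
    show ?thesis
      unfolding Walk_formula_def sat.simps(6) sat_derived(2) all
      by (intro arg_cong2[where f = "(\<and>)"] all_cong letter(1) start stop edge)
  qed
  have rhs_iff: "?rhs \<longleftrightarrow> walk_word m I F E ?w"
    unfolding walk_word_def hd last len all_first_iff[OF n] all_last_iff[OF n] all_successive_iff
    using ne by (simp only: not_False_eq_True simp_thms)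
  have hd_in: "hd xs \<in> univ S" using hd_in_set[OF \<open>xs \<noteq> []\<close>] unfolding xs(2) .
  show ?thesis
    unfolding models_iff_sat[OF msol_sentence_Walk_formula hd_in] sat_iff by (rule rhs_iff)
qed

text \<open>All letters of a walk word are singletons, so it is a sequence of indices into
  \<open>st\<close>; distinctness of \<open>st\<close> identifies indices with states.\<close>

lemma card_walk_words:
  assumes st: "distinct st"
  shows "card {w. length w = n \<and> set w \<subseteq> Pow {..<length st} \<and>
      walk_word (length st) (\<lambda>q. I (st ! q)) (\<lambda>q. F (st ! q)) (\<lambda>q q'. E (st ! q) (st ! q')) w}
    = card {qs \<in> walks (set st) I E n. F (last qs)}"
proof -
  let ?m = "length st"
  let ?W = "walk_word ?m (\<lambda>q. I (st ! q)) (\<lambda>q. F (st ! q)) (\<lambda>q q'. E (st ! q) (st ! q'))"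
  let ?A = "{w. length w = n \<and> set w \<subseteq> Pow {..<?m} \<and> ?W w}"
  let ?B = "{qs \<in> walks (set st) I E n. F (last qs)}"
  \<comment> \<open>Applied to singletons, for which the description is unique.\<close>
  define dec where "dec = (\<lambda>l :: nat set. st ! (THE q. l = {q}))"
  define enc where "enc = (\<lambda>s. {q. q < ?m \<and> st ! q = s})"
  have dec: "dec {q} = st ! q" for q by (simp add: dec_def)
  have enc: "enc (st ! q) = {q}" if "q < ?m" for q
    using that st by (auto simp: enc_def nth_eq_iff_index_eq)
  have "bij_betw (map dec) ?A ?B"
  proof (rule bij_betw_byWitness[where f' = "map enc"])
    show "\<forall>w\<in>?A. map enc (map dec w) = w"
    proof
      fix w assume "w \<in> ?A"
      then have "\<forall>i<length w. \<exists>q<?m. w ! i = {q}" by (simp add: walk_word_def)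
      then have "enc (dec l) = l" if "l \<in> set w" for l
        using that by (metis dec enc in_set_conv_nth)
      then show "map enc (map dec w) = w" by (simp add: map_idI)
    qed
    show "\<forall>qs\<in>?B. map dec (map enc qs) = qs"
    proof
      fix qs assume "qs \<in> ?B"
      then have "\<forall>s\<in>set qs. \<exists>q<?m. s = st ! q"
        by (auto simp: walks_def in_set_conv_nth) (metis in_set_conv_nth nth_mem subsetD)
      then show "map dec (map enc qs) = qs"
        by (auto simp: dec enc intro!: map_idI)
    qed
    show "map dec ` ?A \<subseteq> ?B"
    proof (rule image_subsetI)
      fix w assume w: "w \<in> ?A"
      then have W: "?W w" and ne: "w \<noteq> []" by (simp_all add: walk_word_def)
      have "set (map dec w) \<subseteq> set st"
        using W by (auto simp: walk_word_def in_set_conv_nth) (metis dec)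
      moreover have "I (hd (map dec w))" "F (last (map dec w))"
        using W ne by (auto simp: walk_word_def hd_map last_map dec)
      moreover have "successively E (map dec w)"
        using W by (force simp: walk_word_def successively_conv_nth dec)
      ultimately show "map dec w \<in> ?B" using w ne by (simp add: walks_def)
    qed
    show "map enc ` ?B \<subseteq> ?A"
    proof (rule image_subsetI)
      fix qs assume "qs \<in> ?B"
      then have qs: "length qs = n" "set qs \<subseteq> set st" "qs \<noteq> []" "I (hd qs)" "F (last qs)" "successively E qs"
        by (auto simp: walks_def)
      have idx: "\<exists>q<?m. st ! q = s \<and> enc s = {q}" if "s \<in> set qs" for s
        using that qs(2) enc by (metis in_set_conv_nth subsetD)
      have "\<exists>q<?m. map enc qs ! i = {q}" if "i < length qs" for i
        using idx[of "qs ! i"] that by auto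
      moreover have "\<exists>q<?m. I (st ! q) \<and> hd (map enc qs) = {q}"
        using idx[of "hd qs"] qs by (auto simp: hd_map)
      moreover have "\<exists>q<?m. F (st ! q) \<and> last (map enc qs) = {q}"
        using idx[of "last qs"] qs by (auto simp: last_map)
      moreover have "\<exists>q<?m. \<exists>q'<?m. E (st ! q) (st ! q') \<and> map enc qs ! i = {q} \<and> map enc qs ! Suc i = {q'}"
        if "Suc i < length qs" for i
      proof -
        have "E (qs ! i) (qs ! Suc i)" using qs(6) that by (simp add: successively_conv_nth)
        then show ?thesis using idx[of "qs ! i"] idx[of "qs ! Suc i"] that by auto
      qed
      ultimately show "map enc qs \<in> ?A"
        using qs(1,3) by (auto simp: walk_word_def enc_def)
    qed
  qed
  then show ?thesis by (rule bij_betw_same_card)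
qed

text \<open>The states are numbered in order to serve as relation symbols. The number of walks
  refers to no order, whence the invariance.\<close>

lemma walks_msol_specker:
  assumes "finite Q"
  shows "counting_order_invariant_msol_specker 1 (\<lambda>n. card {qs \<in> walks Q I E n. F (last qs)})"
proof -
  obtain st where st: "distinct st" "set st = Q" using finite_distinct_list[OF assms] by blast
  let ?m = "length st"
  let ?W = "walk_word ?m (\<lambda>q. I (st ! q)) (\<lambda>q. F (st ! q)) (\<lambda>q q'. E (st ! q) (st ! q'))"
  let ?\<phi> = "Walk_formula ?m (\<lambda>q. I (st ! q)) (\<lambda>q. F (st ! q)) (\<lambda>q q'. E (st ! q) (st ! q'))"
  define \<rho> :: "nat list" where "\<rho> = replicate ?m 1"
  define D :: "nat ostruct set" where "D = {S. ordered_structure \<rho> S \<and> models S ?\<phi>}"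
  have \<rho>: "\<forall>r\<in>set \<rho>. r = 1" "length \<rho> = ?m" by (auto simp: \<rho>_def)
  have "osp \<rho> D n l = card {qs \<in> walks Q I E n. F (last qs)}"
    if n: "n \<ge> 1" and l: "lin_order_of {1..n} l" for n l
  proof -
    obtain xs where xs: "enumerates xs {1..n} l" using enumeration_exists[OF _ l] by auto
    then have set: "distinct xs" "set xs = {1..n}" by (auto simp: enumerates_def)
    then have "xs \<noteq> []" using n by auto
    have "\<lparr>univ = {1..n}, ord_rel = l, rels = Rs\<rparr> \<in> D \<longleftrightarrow> ?W (rel_word xs Rs)"
      if "rel_interp \<rho> {1..n} Rs" for Rs
    proof -
      have "length Rs = ?m" using that \<rho>(2) by (auto simp: rel_interp_def dest: list_all2_lengthD)
      then have "models \<lparr>univ = {1..n}, ord_rel = l, rels = Rs\<rparr> ?\<phi> \<longleftrightarrow> ?W (rel_word xs Rs)"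
        using models_Walk_formula[of xs "\<lparr>univ = {1..n}, ord_rel = l, rels = Rs\<rparr>"] xs \<open>xs \<noteq> []\<close> by simp
      then show ?thesis using that l n by (simp add: D_def ordered_structure_def)
    qed
    then show ?thesis
      using osp_eq_card_words[OF \<rho>(1) set, of l D ?W] card_walk_words[OF st(1)] st(2) \<rho>(2) by simp
  qed
  moreover have "msol_definable \<rho> D"
    unfolding msol_definable_def D_def using msol_sentence_Walk_formula \<rho>_def by blast
  moreover have "ordered_class \<rho> D" by (simp add: ordered_class_def D_def)
  ultimately show ?thesis
    unfolding counting_order_invariant_msol_specker_def using \<rho>(1)
    by (intro exI[of _ \<rho>] exI[of _ D]) auto
qed

section \<open>Integer linear systems as signed counts of walks\<close>

lemma walks_Suc:
  assumes "n \<ge> 1"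
  shows "walks Q I E (Suc n) =
    (\<lambda>p. fst p @ [snd p]) ` (SIGMA qs:walks Q I E n. {s \<in> Q. E (last qs) s})"
proof (intro equalityI subsetI)
  fix w assume w: "w \<in> walks Q I E (Suc n)"
  then obtain qs s where "w = qs @ [s]" by (cases w rule: rev_cases) (auto simp: walks_def)
  moreover have "qs \<noteq> []" using w assms calculation by (auto simp: walks_def)
  ultimately show "w \<in> (\<lambda>p. fst p @ [snd p]) ` (SIGMA qs:walks Q I E n. {s \<in> Q. E (last qs) s})"
    using w by (intro image_eqI[of _ _ "(qs, s)"]) (auto simp: walks_def successively_append_iff)
qed (auto simp: walks_def successively_append_iff)

text \<open>A walk is prolonged at its end because component and sign are read off its last state.
  Since there is no walk of length 0, the step starts at 1.\<close>

lemma sum_walks_Suc: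
  assumes "n \<ge> 1" "finite Q"
  shows "(\<Sum>w\<in>walks Q I E (Suc n). g (last w)) = (\<Sum>qs\<in>walks Q I E n. \<Sum>s | s \<in> Q \<and> E (last qs) s. g s)"
proof -
  have inj: "inj_on (\<lambda>p. fst p @ [snd p]) (SIGMA qs:walks Q I E n. {s \<in> Q. E (last qs) s})"
    by (auto simp: inj_on_def)
  show ?thesis
    unfolding walks_Suc[OF assms(1)] using assms(2)
    by (simp add: sum.reindex[OF inj] sum.Sigma finite_walks split_beta o_def)
qed

lemma walks_1: "walks Q I E 1 = (\<lambda>s. [s]) ` {s \<in> Q. I s}"
  by (auto simp: walks_def length_Suc_conv)

text \<open>
  Integer weights are realised by signed walks: a state consists of a component, a sign and a
  copy number below a common bound \<open>K\<close> of the weights, and an edge of weight \<open>z\<close> leads to the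
  \<open>\<bar>z\<bar>\<close> first copies and changes the sign iff \<open>z < 0\<close>.
\<close>

lemma linear_system_difference:
  fixes x :: "nat \<Rightarrow> nat \<Rightarrow> int"
  assumes rec: "\<And>n i. n \<ge> 1 \<Longrightarrow> i < d \<Longrightarrow> x (Suc n) i = (\<Sum>j<d. a i j * x n j)" and "k < d"
  obtains f1 f2 where "counting_order_invariant_msol_specker 1 f1"
    "counting_order_invariant_msol_specker 1 f2" "\<And>n. n \<ge> 1 \<Longrightarrow> x n k = int (f1 n) - int (f2 n)"
proof -
  define B where "B = (\<lambda>(i, j). nat \<bar>a i j\<bar>) ` ({..<d} \<times> {..<d}) \<union> (\<lambda>i. nat \<bar>x 1 i\<bar>) ` {..<d}"
  have "finite B" by (simp add: B_def)
  then obtain K where K: "\<And>b. b \<in> B \<Longrightarrow> b \<le> K"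
    by (meson finite_nat_set_iff_bounded_le)
  have Ka: "nat \<bar>a i j\<bar> \<le> K" if "i < d" "j < d" for i j
    by (rule K) (use that in \<open>force simp: B_def\<close>)
  have Kx: "nat \<bar>x 1 i\<bar> \<le> K" if "i < d" for i
    by (rule K) (use that in \<open>auto simp: B_def\<close>)
  define Q :: "(nat \<times> bool \<times> nat) set" where "Q = {..<d} \<times> UNIV \<times> {..<K}"
  \<comment> \<open>The initial vector: component \<open>i\<close> starts in as many copies as the
    absolute value of \<open>x 1 i\<close>, all with the sign of that number.\<close>
  define I where "I = (\<lambda>(i, b, c). b = (x 1 i < 0) \<and> c < nat \<bar>x 1 i\<bar>)"
  \<comment> \<open>An edge from component \<open>j\<close> to component \<open>i\<close> has weight
    \<open>a i j\<close>, so lengthening a walk by one state applies the matrix once. The copy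
    number of the source is immaterial.\<close>
  define E where "E = (\<lambda>(j :: nat, b, c :: nat) (i, b', c'). b' = (b \<noteq> (a i j < 0)) \<and> c' < nat \<bar>a i j\<bar>)"
  define sg :: "nat \<times> bool \<times> nat \<Rightarrow> int" where "sg = (\<lambda>(i, b, c). if b then - 1 else 1)"
  have fin: "finite Q" by (simp add: Q_def)
  have main: "x n i = (\<Sum>w\<in>walks Q I E n. if fst (last w) = i then sg (last w) else 0)"
    if "n \<ge> 1" "i < d" for n i
    using that
  proof (induction n arbitrary: i rule: dec_induct)
    case base
    have "(\<Sum>w\<in>walks Q I E 1. if fst (last w) = i then sg (last w) else 0) =
        (\<Sum>s | s \<in> Q \<and> I s. if fst s = i then sg s else 0)"
      unfolding walks_1 by (subst sum.reindex) (auto simp: inj_on_def cong: if_cong)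
    also have "\<dots> = (\<Sum>s | s \<in> Q \<and> I s \<and> fst s = i. sg s)"
      using fin by (simp add: sum.If_cases Int_def conj_assoc)
    also have "{s. s \<in> Q \<and> I s \<and> fst s = i} = {i} \<times> {x 1 i < 0} \<times> {..<nat \<bar>x 1 i\<bar>}"
      using base Kx[of i] by (auto simp: Q_def I_def)
    also have "(\<Sum>s\<in>\<dots>. sg s) = (\<Sum>s\<in>{i} \<times> {x 1 i < 0} \<times> {..<nat \<bar>x 1 i\<bar>}. if x 1 i < 0 then - 1 else 1)"
      by (rule sum.cong) (auto simp: sg_def)
    also have "\<dots> = x 1 i" by (simp add: card_cartesian_product)
    finally show ?case by simp
  next
    case (step n)
    \<comment> \<open>The successors of \<open>q\<close> in component \<open>i\<close> all have the
      same sign, so their signed number is the weight times the sign of \<open>q\<close>.\<close>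
    have weight: "(\<Sum>s | s \<in> Q \<and> E q s. if fst s = i then sg s else 0) = a i (fst q) * sg q"
      if "q \<in> Q" for q
    proof -
      obtain j b c where q: "q = (j, b, c)" by (cases q)
      then have "j < d" using that by (simp add: Q_def)
      have "(\<Sum>s | s \<in> Q \<and> E q s. if fst s = i then sg s else 0) =
          (\<Sum>s | s \<in> Q \<and> E q s \<and> fst s = i. sg s)"
        using fin by (simp add: sum.If_cases Int_def conj_assoc)
      also have "{s. s \<in> Q \<and> E q s \<and> fst s = i} = {i} \<times> {b \<noteq> (a i j < 0)} \<times> {..<nat \<bar>a i j\<bar>}"
        using step.prems \<open>j < d\<close> Ka[of i j] by (auto simp: Q_def E_def q)
      also have "(\<Sum>s\<in>\<dots>. sg s) =
          (\<Sum>s\<in>{i} \<times> {b \<noteq> (a i j < 0)} \<times> {..<nat \<bar>a i j\<bar>}. if b \<noteq> (a i j < 0) then - 1 else 1)"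
        by (rule sum.cong) (auto simp: sg_def)
      also have "\<dots> = a i j * sg q" by (simp add: card_cartesian_product sg_def q)
      finally show ?thesis by (simp add: q)
    qed
    have last: "last w \<in> Q" if "w \<in> walks Q I E n" for w
      using that by (auto simp: walks_def)
    have "(\<Sum>w\<in>walks Q I E (Suc n). if fst (last w) = i then sg (last w) else 0) =
        (\<Sum>w\<in>walks Q I E n. a i (fst (last w)) * sg (last w))"
      unfolding sum_walks_Suc[OF step.hyps(1) fin, where g = "\<lambda>s. if fst s = i then sg s else 0"]
      by (intro sum.cong refl weight last)
    \<comment> \<open>Exactly one \<open>j\<close> is the component of the last state. Summing over
      all \<open>j\<close> brings in the induction hypothesis for every component.\<close>
    also have "\<dots> = (\<Sum>w\<in>walks Q I E n. \<Sum>j<d. a i j * (if fst (last w) = j then sg (last w) else 0))"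
    proof (rule sum.cong[OF refl])
      fix w assume "w \<in> walks Q I E n"
      then have "fst (last w) < d" using last by (force simp: Q_def)
      then have "a i (fst (last w)) * sg (last w) =
          (\<Sum>j<d. if fst (last w) = j then a i j * sg (last w) else 0)"
        by (simp add: sum.delta')
      also have "\<dots> = (\<Sum>j<d. a i j * (if fst (last w) = j then sg (last w) else 0))"
        by (rule sum.cong) auto
      finally show "a i (fst (last w)) * sg (last w) =
          (\<Sum>j<d. a i j * (if fst (last w) = j then sg (last w) else 0))" .
    qed
    also have "\<dots> = (\<Sum>j<d. a i j * x n j)"
      unfolding sum.swap[of _ "{..<d}"]
      by (rule sum.cong) (simp_all add: step.IH sum_distrib_left)
    finally show ?case using rec[OF step.hyps(1) step.prems] by simp
  qed
  \<comment> \<open>The walks that end in component \<open>k\<close>, separated by the sign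
    \<open>b\<close> of the last state, where \<open>True\<close> stands for negative.\<close>
  define f where "f = (\<lambda>b n. card {w \<in> walks Q I E n. fst (last w) = k \<and> fst (snd (last w)) = b})"
  have "counting_order_invariant_msol_specker 1 (f b)" for b
    unfolding f_def by (rule walks_msol_specker[OF fin])
  moreover have "x n k = int (f False n) - int (f True n)" if "n \<ge> 1" for n
  proof -
    have "x n k = (\<Sum>w\<in>walks Q I E n.
        (if fst (last w) = k \<and> fst (snd (last w)) = False then 1 else 0) -
        (if fst (last w) = k \<and> fst (snd (last w)) = True then 1 else 0))"
      unfolding main[OF that \<open>k < d\<close>] by (rule sum.cong) (auto simp: sg_def split: prod.splits)
    moreover have "(\<Sum>w\<in>walks Q I E n. if P w then 1 else 0) = int (card {w \<in> walks Q I E n. P w})" for P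
      by (simp add: sum.inter_filter[symmetric] finite_walks[OF fin])
    ultimately show ?thesis by (simp only: f_def sum_subtractf)
  qed
  ultimately show ?thesis using that by blast
qed

lemma recurrence_imp_difference:
  assumes "satisfies_linear_recurrence f"
  obtains f1 f2 where "counting_order_invariant_msol_specker 1 f1"
    "counting_order_invariant_msol_specker 1 f2" "\<And>n. n \<ge> 1 \<Longrightarrow> f n = int (f1 n) - int (f2 n)"
proof -
  obtain d a where d: "d \<ge> 1" and rec: "\<And>n. n > d \<Longrightarrow> f n = (\<Sum>j=1..d. a j * f (n - j))"
    using assms unfolding satisfies_linear_recurrence_def by blast
  \<comment> \<open>The companion matrix acting on the window from \<open>f n\<close> to
    \<open>f (n + d - 1)\<close>: every row but the last shifts the window, and the last one is the
    recurrence with its coefficients reversed.\<close>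
  define A :: "nat \<Rightarrow> nat \<Rightarrow> int" where
    "A = (\<lambda>i j. if Suc i < d then (if j = Suc i then 1 else 0) else a (d - j))"
  have "f (Suc n + i) = (\<Sum>j<d. A i j * f (n + j))" if "n \<ge> 1" "i < d" for n i
  proof (cases "Suc i < d")
    case True
    then show ?thesis by (simp add: A_def if_distrib[of "\<lambda>c. c * _"] cong: if_cong)
  next
    case False
    then have i: "Suc n + i = n + d" using that by simp
    \<comment> \<open>Since \<open>n\<close> is at least 1, the argument \<open>n + d\<close>
      exceeds \<open>d\<close>, where the recurrence is valid.\<close>
    have "f (n + d) = (\<Sum>j=1..d. a j * f (n + d - j))" using rec that by simp
    also have "\<dots> = (\<Sum>j<d. a (d - j) * f (n + j))"
      by (rule sum.reindex_bij_witness[of _ "\<lambda>j. d - j" "\<lambda>j. d - j"]) auto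
    finally show ?thesis unfolding i using False by (simp add: A_def)
  qed
  then show ?thesis
    using linear_system_difference[of d "\<lambda>n i. f (n + i)" A 0] d that by auto
qed

theorem theorem10:
  fixes f :: "nat \<Rightarrow> nat"
  shows "satisfies_linear_recurrence (\<lambda>n. int (f n)) \<longleftrightarrow>
    (\<exists>f1 f2. counting_order_invariant_msol_specker 1 f1 \<and>
             counting_order_invariant_msol_specker 1 f2 \<and>
             (\<forall>n\<ge>1. int (f n) = int (f1 n) - int (f2 n)))"
proof
  assume "satisfies_linear_recurrence (\<lambda>n. int (f n))"
  then show "\<exists>f1 f2. counting_order_invariant_msol_specker 1 f1 \<and>
      counting_order_invariant_msol_specker 1 f2 \<and> (\<forall>n\<ge>1. int (f n) = int (f1 n) - int (f2 n))"
    by (rule recurrence_imp_difference) blast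
next
  assume "\<exists>f1 f2. counting_order_invariant_msol_specker 1 f1 \<and>
      counting_order_invariant_msol_specker 1 f2 \<and> (\<forall>n\<ge>1. int (f n) = int (f1 n) - int (f2 n))"
  then obtain f1 f2 where f: "counting_order_invariant_msol_specker 1 f1"
    "counting_order_invariant_msol_specker 1 f2" "\<And>n. n \<ge> 1 \<Longrightarrow> int (f n) = int (f1 n) - int (f2 n)"
    by blast
  obtain g1 where g1: "C_recursive g1" "\<And>n. n \<ge> 1 \<Longrightarrow> int (f1 n) = g1 n"
    using C_recursive_specker[OF f(1)] by blast
  obtain g2 where g2: "C_recursive g2" "\<And>n. n \<ge> 1 \<Longrightarrow> int (f2 n) = g2 n"
    using C_recursive_specker[OF f(2)] by blast
  show "satisfies_linear_recurrence (\<lambda>n. int (f n))"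
    by (rule satisfies_linear_recurrenceI[OF C_recursive_diff[OF g1(1) g2(1)]])
      (simp add: f(3) g1(2) g2(2))
qed

end
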